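(* Let $(h_j)_j$ be positive numbers with $h_j=o(2^{-2j})$ as $j\to\infty$. Let $\Phi=\{\psi_\lambda\}_\lambda$ be the 2D Meyer Parseval wavelet system of $L^2(\mathbb{R}^2)$ and let $f_j=P_{\mathbb{R}^2\setminus\mathcal{M}_{h_j}}\,w\mathcal{L}_j$. There exist thresholds $\beta_j>0$ such that, with $\mathcal{T}_j=\{\lambda:|\langle f_j,\psi_\lambda\rangle|\ge\beta_j\}$ and the one-step hard thresholding reconstruction $$L_j=\Phi\,\mathbb{1}_{\mathcal{T}_j}\Phi^\ast f_j ,$$ one has $$\frac{\|L_j-w\mathcal{L}_j\|_2}{\|w\mathcal{L}_j\|_2}\to 0,\qquad j\to\infty .$$
   Context: Fourier transform: $\hat f(\xi)=\int f(x)e^{-2\pi i\langle x,\xi\rangle}dx$; $\check f$ (or $f^\vee$) is the inverse transform. Meyer functions. Fix $\nu\in C^\infty(\mathbb{R})$ with $\nu(x)+\nu(1-x)=1$ for all $x$, $\nu(x)=0$ for $x\le 0$, $\nu(x)=1$ for $x\ge1$. Let $W(\xi)=e^{-16\pi i\xi/3}\sin[\frac{\pi}{2}\nu(16|\xi|-1)]$ for $\frac1{16}\le|\xi|\le\frac18$, $W(\xi)=e^{-16\pi i\xi/3}\cos[\frac{\pi}{2}\nu(8|\xi|-1)]$ for $\frac18\le|\xi|\le\frac14$, $W(\xi)=0$ otherwise; and $\hat\phi(\xi)=1$ for $|\xi|\le\frac1{16}$, $\hat\phi(\xi)=\cos[\frac{\pi}{2}\nu(16|\xi|-1)]$ for $\frac1{16}\le|\xi|\le\frac18$,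 $\hat\phi(\xi)=0$ otherwise. For $\xi=(\xi_1,\xi_2)$ set $W^v(\xi)=\hat\phi(\xi_1)W(\xi_2)$, $W^h(\xi)=W(\xi_1)\hat\phi(\xi_2)$, $W^d(\xi)=W(\xi_1)W(\xi_2)$. Meyer Parseval system: $\{\psi_\lambda:\lambda=(\iota,j,k),\ \iota\in\{h,v,d\},\ j\in\mathbb{Z},\ k\in\mathbb{Z}^2\}$ with $\hat\psi_\lambda(\xi)=2^{-j}W^\iota(\xi/2^j)e^{-2\pi i\langle k,\xi/2^j\rangle}$. It is a Parseval frame. $\Phi^\ast x=(\langle x,\psi_\lambda\rangle)_\lambda$ is the analysis operator, $\Phi c=\sum_\lambda c_\lambda\psi_\lambda$ the synthesis operator, and $\mathbb{1}_{\mathcal{T}}$ restricts a sequence to the index set $\mathcal{T}$ (zero elsewhere). Image model. $\rho>0$, and $w:\mathbb{R}\to[0,1]$ is a smooth function supported in $[-\rho,\rho]$, not identically zero. $w\mathcal{L}$ is the tempered distribution on $\mathbb{R}^2$ given on Schwartz functions by $\langle w\mathcal{L},g\rangle=\int_{-\rho}^\rho w(x_1)g(x_1,0)\,dx_1$. Let $F_j(\xi)=\sum_{\iota\in\{h,v,d\}}\big(W^\iota(2^{-2j}\xi)+W^\iota(2^{-2j-1}\xi)\big)$ and $w\mathcal{L}_j=w\mathcal{L}\star\check F_j$, i.e. $\widehat{w\mathcal{L}_j}(\xi)=\hat w(\xi_1)F_j(\xi)$. Mask. $\mathcal{M}_h=\mathbb{1}_{\{|x_1|\le h\}}$; $P_{\mathbb{R}^2\setminus\mathcal{M}_h}$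 is the orthogonal projection of $L^2(\mathbb{R}^2)$ given by multiplication with $1-\mathcal{M}_h$. Standing assumption: $\rho$ is sufficiently large, in particular much larger than $h_j$ (so $h_j<\rho$). *)

theory Defs
  imports "HOL-Analysis.Analysis" "HOL-Library.Landau_Symbols"
begin

definition smooth :: "(real \<Rightarrow> real) \<Rightarrow> bool" where
  "smooth f \<longleftrightarrow> (\<forall>n x. ((deriv ^^ n) f) differentiable (at x))"

definition fourier_inv :: "('a::euclidean_space \<Rightarrow> complex) \<Rightarrow> 'a \<Rightarrow> complex" where
  "fourier_inv g x = (\<integral>\<xi>. g \<xi> * cis (2 * pi * (x \<bullet> \<xi>)) \<partial>lborel)"

text \<open>Elements of the complex \<open>L\<^sup>2\<close> space of the plane are represented by functions. Since Bochner
  integrals of non-integrable functions are 0, \<open>L2_norm\<close> is meaningful only on functions in \<open>L2\<close>.\<close>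

definition L2 :: "(real \<times> real \<Rightarrow> complex) set" where
  "L2 = {f. f \<in> borel_measurable lborel \<and> integrable lborel (\<lambda>x. (cmod (f x))\<^sup>2)}"

definition L2_norm :: "(real \<times> real \<Rightarrow> complex) \<Rightarrow> real" where
  "L2_norm f = sqrt (\<integral>x. (cmod (f x))\<^sup>2 \<partial>lborel)"

definition L2_inner :: "(real \<times> real \<Rightarrow> complex) \<Rightarrow> (real \<times> real \<Rightarrow> complex) \<Rightarrow> complex" where
  "L2_inner f g = (\<integral>x. f x * cnj (g x) \<partial>lborel)"

definition meyer_aux :: "(real \<Rightarrow> real) \<Rightarrow> bool" where
  "meyer_aux \<nu> \<longleftrightarrow> smooth \<nu> \<and> (\<forall>x. \<nu> x + \<nu> (1 - x) = 1) \<and>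
     (\<forall>x\<le>0. \<nu> x = 0) \<and> (\<forall>x\<ge>1. \<nu> x = 1)"

definition W :: "(real \<Rightarrow> real) \<Rightarrow> real \<Rightarrow> complex" where
  "W \<nu> \<xi> =
     (if 1/16 \<le> \<bar>\<xi>\<bar> \<and> \<bar>\<xi>\<bar> \<le> 1/8 then
        cis (- 16 * pi * \<xi> / 3) * complex_of_real (sin (pi/2 * \<nu> (16 * \<bar>\<xi>\<bar> - 1)))
      else if 1/8 \<le> \<bar>\<xi>\<bar> \<and> \<bar>\<xi>\<bar> \<le> 1/4 then
        cis (- 16 * pi * \<xi> / 3) * complex_of_real (cos (pi/2 * \<nu> (8 * \<bar>\<xi>\<bar> - 1)))
      else 0)"

definition phi_hat :: "(real \<Rightarrow> real) \<Rightarrow> real \<Rightarrow> complex" where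
  "phi_hat \<nu> \<xi> =
     (if \<bar>\<xi>\<bar> \<le> 1/16 then 1
      else if 1/16 \<le> \<bar>\<xi>\<bar> \<and> \<bar>\<xi>\<bar> \<le> 1/8 then
        complex_of_real (cos (pi/2 * \<nu> (16 * \<bar>\<xi>\<bar> - 1)))
      else 0)"

datatype orientation = Hor | Ver | Dia

fun W2 :: "(real \<Rightarrow> real) \<Rightarrow> orientation \<Rightarrow> real \<times> real \<Rightarrow> complex" where
  "W2 \<nu> Ver (\<xi>1, \<xi>2) = phi_hat \<nu> \<xi>1 * W \<nu> \<xi>2"
| "W2 \<nu> Hor (\<xi>1, \<xi>2) = W \<nu> \<xi>1 * phi_hat \<nu> \<xi>2"
| "W2 \<nu> Dia (\<xi>1, \<xi>2) = W \<nu> \<xi>1 * W \<nu> \<xi>2"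

type_synonym meyer_index = "orientation \<times> int \<times> (int \<times> int)"

fun psi_hat :: "(real \<Rightarrow> real) \<Rightarrow> meyer_index \<Rightarrow> real \<times> real \<Rightarrow> complex" where
  "psi_hat \<nu> (\<iota>, j, (k1, k2)) \<xi> =
     complex_of_real (2 powi (- j)) * W2 \<nu> \<iota> (\<xi> /\<^sub>R 2 powi j)
       * cis (- 2 * pi * ((of_int k1, of_int k2) \<bullet> (\<xi> /\<^sub>R 2 powi j)))"

definition psi :: "(real \<Rightarrow> real) \<Rightarrow> meyer_index \<Rightarrow> real \<times> real \<Rightarrow> complex" where
  "psi \<nu> l = fourier_inv (psi_hat \<nu> l)"

definition analysis_op ::
    "(real \<Rightarrow> real) \<Rightarrow> (real \<times> real \<Rightarrow> complex) \<Rightarrow> meyer_index \<Rightarrow> complex" where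
  "analysis_op \<nu> f = (\<lambda>l. L2_inner f (psi \<nu> l))"

text \<open>The synthesis operator as a relation: \<open>is_synthesis \<nu> c g\<close> says that the series of the
  \<open>c l * psi \<nu> l\<close> over all indices converges unconditionally in \<open>L\<^sup>2\<close> with sum \<open>g\<close>, so that \<open>g\<close> is
  determined up to a null set.\<close>

definition is_synthesis ::
    "(real \<Rightarrow> real) \<Rightarrow> (meyer_index \<Rightarrow> complex) \<Rightarrow> (real \<times> real \<Rightarrow> complex) \<Rightarrow> bool" where
  "is_synthesis \<nu> c g \<longleftrightarrow> g \<in> L2 \<and>
     ((\<lambda>F. L2_norm (\<lambda>x. (\<Sum>l\<in>F. c l * psi \<nu> l x) - g x)) \<longlongrightarrow> 0) (finite_subsets_at_top UNIV)"

definition restrict_seq :: "'i set \<Rightarrow> ('i \<Rightarrow> complex) \<Rightarrow> 'i \<Rightarrow> complex" where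
  "restrict_seq T c = (\<lambda>l. if l \<in> T then c l else 0)"

definition image_weight :: "real \<Rightarrow> (real \<Rightarrow> real) \<Rightarrow> bool" where
  "image_weight \<rho> w \<longleftrightarrow> smooth w \<and> (\<forall>x. 0 \<le> w x \<and> w x \<le> 1) \<and>
     (\<forall>x. x \<notin> {-\<rho>..\<rho>} \<longrightarrow> w x = 0) \<and> (\<exists>x. w x \<noteq> 0)"

definition wL :: "real \<Rightarrow> (real \<Rightarrow> real) \<Rightarrow> (real \<times> real \<Rightarrow> complex) \<Rightarrow> complex" where
  "wL \<rho> w g = (LINT x1:{-\<rho>..\<rho>}|lborel. complex_of_real (w x1) * g (x1, 0))"

text \<open>Convolution of a distribution with a (Schwartz) function.\<close>

definition dist_conv ::
    "((real \<times> real \<Rightarrow> complex) \<Rightarrow> complex) \<Rightarrow> (real \<times> real \<Rightarrow> complex) \<Rightarrow> real \<times> real \<Rightarrow> complex" where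
  "dist_conv T g x = T (\<lambda>y. g (x - y))"

definition F_filter :: "(real \<Rightarrow> real) \<Rightarrow> nat \<Rightarrow> real \<times> real \<Rightarrow> complex" where
  "F_filter \<nu> j \<xi> =
     (\<Sum>\<iota>\<in>{Hor, Ver, Dia}. W2 \<nu> \<iota> (\<xi> /\<^sub>R 2 ^ (2 * j)) + W2 \<nu> \<iota> (\<xi> /\<^sub>R 2 ^ (2 * j + 1)))"

definition wL_band :: "(real \<Rightarrow> real) \<Rightarrow> real \<Rightarrow> (real \<Rightarrow> real) \<Rightarrow> nat \<Rightarrow> real \<times> real \<Rightarrow> complex" where
  "wL_band \<nu> \<rho> w j = dist_conv (wL \<rho> w) (fourier_inv (F_filter \<nu> j))"

definition mask :: "real \<Rightarrow> (real \<times> real) set" where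
  "mask h = {x. \<bar>fst x\<bar> \<le> h}"

definition proj_known :: "real \<Rightarrow> (real \<times> real \<Rightarrow> complex) \<Rightarrow> real \<times> real \<Rightarrow> complex" where
  "proj_known h f = (\<lambda>x. (1 - indicator (mask h) x) * f x)"

definition thresh_set ::
    "(real \<Rightarrow> real) \<Rightarrow> (real \<times> real \<Rightarrow> complex) \<Rightarrow> real \<Rightarrow> meyer_index set" where
  "thresh_set \<nu> f \<beta> = {l. cmod (L2_inner f (psi \<nu> l)) \<ge> \<beta>}"

end

theory Submission
  imports Defs
begin

text \<open>
  The thresholds are at our disposal, and very small ones suffice. Write \<open>g\<close> for the band-limited
  image, \<open>f\<close> for its known part and \<open>s = 2\<^sup>2\<^sup>j\<close>. The Meyer system is a Parseval frame, so keeping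
  enough coefficients of \<open>f\<close> reproduces \<open>g\<close> up to an error controlled by \<open>f - g\<close>, and everything comes
  down to the fact that the masked part of \<open>g\<close> carries a vanishing share of the energy of \<open>g\<close>:

  \<^item> \<open>wL_band_energy_lower\<close>: the energy of \<open>g\<close> is at least \<open>c s\<close>. Its Fourier transform is
    \<open>weight_hat w \<xi>\<^sub>1 * F\<^sub>j \<xi>\<close>; the first factor is bounded away from 0 near \<open>\<xi>\<^sub>1 = 0\<close> because \<open>w\<close> has
    positive integral, and there the second factor is a fixed profile dilated by \<open>s\<close> in \<open>\<xi>\<^sub>2\<close>.
  \<^item> \<open>wL_band_masked_energy\<close>: the energy of \<open>g\<close> in the strip of half-width \<open>h\<close> is at most a constant
    times \<open>h s\<^sup>2\<close>. By the Cauchy-Schwarz inequality along horizontal lines the energy density of \<open>g\<close>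
    at \<open>x\<^sub>1\<close> is at most a constant times the full energy of the inverse transform of \<open>F\<^sub>j\<close>, which is of
    order \<open>s\<^sup>2\<close> since \<open>F\<^sub>j\<close> is bounded and lives in a box of side \<open>s\<close>.

  The ratio of the two is of order \<open>h s\<close>, which tends to 0 by the hypothesis on \<open>h\<close>. The lemma
  \<open>thresholding_error\<close> turns this into the theorem: the reconstruction error is at most
  \<open>2 * L2_norm (f - g) + 1\<close>, and the 1 is harmless because the norm of \<open>g\<close> tends to infinity.

  The Fourier analysis is only needed for functions whose spectrum is continuous and boundedly
  supported; \<open>g\<close> and the wavelets are of this kind, and the jump that the mask puts into \<open>f\<close> is
  handled by the Bessel inequality alone. For such spectra everything follows from Parseval's identity
  for Fourier series in a square. Trigonometric polynomials are dense by the Stone-Weierstrass theorem on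
  the torus, which gives Parseval (\<open>fourier_series_Parseval\<close>). Cutting the plane into cells of a lattice
  and applying Parseval to the samples on each translate gives Plancherel (\<open>Plancherel_ip\<close>). Applying
  Parseval to \<open>G\<close> times one dilated Meyer window sums the coefficients over all translates, and the
  squared windows telescope over the scales, which gives the frame identity (\<open>frame_identity\<close>).
\<close>

section \<open>Square-integrable functions\<close>

text \<open>The three notions below are membership, inner product and squared norm (energy) of \<open>L\<^sup>2\<close> over an arbitrary measure: the
  plane is needed for the statement, and the unit cell for Fourier series.\<close>

definition sqint :: "'a measure \<Rightarrow> ('a \<Rightarrow> complex) set" where
  "sqint M = {f. f \<in> borel_measurable M \<and> integrable M (\<lambda>x. (cmod (f x))\<^sup>2)}"

definition ip :: "'a measure \<Rightarrow> ('a \<Rightarrow> complex) \<Rightarrow> ('a \<Rightarrow> complex) \<Rightarrow> complex" where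
  "ip M f g = (\<integral>x. f x * cnj (g x) \<partial>M)"

definition nsq :: "'a measure \<Rightarrow> ('a \<Rightarrow> complex) \<Rightarrow> real" where
  "nsq M f = (\<integral>x. (cmod (f x))\<^sup>2 \<partial>M)"

lemma L2_eq_sqint: "L2 = sqint lborel"
  by (simp add: L2_def sqint_def)

lemma L2_inner_eq_ip: "L2_inner = ip lborel"
  by (simp add: L2_inner_def ip_def fun_eq_iff)

lemma L2_norm_eq_nsq: "L2_norm f = sqrt (nsq lborel f)"
  by (simp add: L2_norm_def nsq_def)

lemma sqint_measurable: "f \<in> sqint M \<Longrightarrow> f \<in> borel_measurable M"
  by (simp add: sqint_def)

lemma sqint_integrable: "f \<in> sqint M \<Longrightarrow> integrable M (\<lambda>x. (cmod (f x))\<^sup>2)"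
  by (simp add: sqint_def)

lemma nsq_nonneg [simp]: "0 \<le> nsq M f"
  by (simp add: nsq_def)

lemma integrable_ip:
  assumes f: "f \<in> sqint M" and g: "g \<in> sqint M"
  shows "integrable M (\<lambda>x. f x * cnj (g x))"
proof (rule Bochner_Integration.integrable_bound)
  show "integrable M (\<lambda>x. (cmod (f x))\<^sup>2 + (cmod (g x))\<^sup>2)"
    using f g by (intro Bochner_Integration.integrable_add sqint_integrable)
  have [measurable]: "f \<in> borel_measurable M" "g \<in> borel_measurable M"
    using f g by (simp_all add: sqint_measurable)
  show "(\<lambda>x. f x * cnj (g x)) \<in> borel_measurable M"
    using borel_measurable_continuous_onI[of cnj] continuous_on_cnj[OF continuous_on_id]
    by (intro borel_measurable_times measurable_compose[of g M borel cnj borel]) simp_all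
  have "a * b \<le> a\<^sup>2 + b\<^sup>2" if "0 \<le> a" "0 \<le> b" for a b :: real
    using sum_squares_bound[of a b] mult_nonneg_nonneg[OF that] by linarith
  then have "norm (f x * cnj (g x)) \<le> (cmod (f x))\<^sup>2 + (cmod (g x))\<^sup>2" for x
    by (simp add: norm_mult)
  then show "AE x in M. norm (f x * cnj (g x)) \<le> norm ((cmod (f x))\<^sup>2 + (cmod (g x))\<^sup>2)"
    by simp
qed

lemma sqint_scale:
  assumes "f \<in> sqint M" shows "(\<lambda>x. c * f x) \<in> sqint M"
  using assms by (auto simp: sqint_def norm_mult power_mult_distrib)

lemma sqint_add:
  assumes f: "f \<in> sqint M" and g: "g \<in> sqint M"
  shows "(\<lambda>x. f x + g x) \<in> sqint M"
proof -
  have [measurable]: "f \<in> borel_measurable M" "g \<in> borel_measurable M"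
    using f g by (simp_all add: sqint_measurable)
  have "integrable M (\<lambda>x. (cmod (f x + g x))\<^sup>2)"
  proof (rule Bochner_Integration.integrable_bound)
    show "integrable M (\<lambda>x. 2 * (cmod (f x))\<^sup>2 + 2 * (cmod (g x))\<^sup>2)"
      using f g by (intro Bochner_Integration.integrable_add integrable_mult_right sqint_integrable)
    have "(cmod (f x + g x))\<^sup>2 \<le> 2 * (cmod (f x))\<^sup>2 + 2 * (cmod (g x))\<^sup>2" for x
    proof -
      have "(cmod (f x + g x))\<^sup>2 \<le> (cmod (f x) + cmod (g x))\<^sup>2"
        by (intro power_mono norm_triangle_ineq norm_ge_zero)
      also have "\<dots> \<le> 2 * (cmod (f x))\<^sup>2 + 2 * (cmod (g x))\<^sup>2"
        using sum_squares_bound[of "cmod (f x)" "cmod (g x)"] by (simp add: power2_sum)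
      finally show ?thesis .
    qed
    then show "AE x in M. norm ((cmod (f x + g x))\<^sup>2)
        \<le> norm (2 * (cmod (f x))\<^sup>2 + 2 * (cmod (g x))\<^sup>2)"
      by simp
  qed simp
  then show ?thesis
    by (simp add: sqint_def)
qed

lemma sqint_sum:
  assumes "\<And>i. i \<in> I \<Longrightarrow> f i \<in> sqint M"
  shows "(\<lambda>x. \<Sum>i\<in>I. f i x) \<in> sqint M"
  using assms
proof (induction I rule: infinite_finite_induct)
  case (insert i I)
  then show ?case by (simp add: sqint_add)
qed (auto simp: sqint_def)

lemma sqint_diff:
  assumes f: "f \<in> sqint M" and g: "g \<in> sqint M"
  shows "(\<lambda>x. f x - g x) \<in> sqint M"
  using sqint_add[OF f sqint_scale[OF g, of "-1"]] by simp

lemma ip_self: "ip M f f = complex_of_real (nsq M f)"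
proof -
  have "f x * cnj (f x) = complex_of_real ((cmod (f x))\<^sup>2)" for x
    by (rule complex_norm_square[symmetric])
  then show ?thesis
    unfolding ip_def nsq_def by (simp only: integral_complex_of_real)
qed

lemma ip_commute: "ip M g f = cnj (ip M f g)"
proof -
  have "cnj (ip M f g) = (\<integral>x. cnj (f x * cnj (g x)) \<partial>M)"
    unfolding ip_def by (rule Bochner_Integration.integral_cnj[symmetric])
  then show ?thesis
    by (simp add: ip_def mult.commute)
qed

lemma ip_scale_left: "ip M (\<lambda>x. c * f x) g = c * ip M f g"
  by (simp add: ip_def mult.assoc)

lemma ip_scale_right: "ip M f (\<lambda>x. c * g x) = cnj c * ip M f g"
  by (metis complex_cnj_mult ip_commute ip_scale_left)

lemma ip_add_left:
  assumes "f \<in> sqint M" "g \<in> sqint M" "k \<in> sqint M"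
  shows "ip M (\<lambda>x. f x + g x) k = ip M f k + ip M g k"
  unfolding ip_def using assms
  by (simp add: distrib_right integrable_ip)

lemma ip_add_right:
  assumes "f \<in> sqint M" "g \<in> sqint M" "k \<in> sqint M"
  shows "ip M k (\<lambda>x. f x + g x) = ip M k f + ip M k g"
  by (metis (mono_tags, lifting) assms complex_cnj_add ip_add_left ip_commute)

lemma ip_diff_left:
  assumes "f \<in> sqint M" "g \<in> sqint M" "k \<in> sqint M"
  shows "ip M (\<lambda>x. f x - g x) k = ip M f k - ip M g k"
  unfolding ip_def using assms
  by (simp add: left_diff_distrib integrable_ip)

lemma ip_sum_left:
  assumes "\<And>i. i \<in> I \<Longrightarrow> f i \<in> sqint M" "k \<in> sqint M"
  shows "ip M (\<lambda>x. \<Sum>i\<in>I. c i * f i x) k = (\<Sum>i\<in>I. c i * ip M (f i) k)"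
proof -
  have "ip M (\<lambda>x. \<Sum>i\<in>I. c i * f i x) k = (\<integral>x. (\<Sum>i\<in>I. c i * f i x * cnj (k x)) \<partial>M)"
    by (simp add: ip_def sum_distrib_right)
  also have "\<dots> = (\<Sum>i\<in>I. (\<integral>x. c i * f i x * cnj (k x) \<partial>M))"
    using assms by (intro Bochner_Integration.integral_sum) (simp add: integrable_ip mult.assoc)
  also have "\<dots> = (\<Sum>i\<in>I. c i * ip M (f i) k)"
    by (simp add: ip_def mult.assoc)
  finally show ?thesis .
qed

lemma ip_sum_right:
  assumes "\<And>i. i \<in> I \<Longrightarrow> f i \<in> sqint M" "k \<in> sqint M"
  shows "ip M k (\<lambda>x. \<Sum>i\<in>I. c i * f i x) = (\<Sum>i\<in>I. cnj (c i) * ip M k (f i))"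
  by (subst ip_commute, subst ip_sum_left[OF assms]) (simp_all add: ip_commute[of M k])

text \<open>The polarised form of the energy of a sum; read backwards it recovers real parts of inner
  products from energies, which is how Plancherel passes from norms to inner products.\<close>

lemma nsq_add:
  assumes "f \<in> sqint M" "g \<in> sqint M"
  shows "nsq M (\<lambda>x. f x + g x) = nsq M f + 2 * Re (ip M f g) + nsq M g"
proof -
  have "complex_of_real (nsq M (\<lambda>x. f x + g x))
      = ip M f f + ip M f g + (cnj (ip M f g) + ip M g g)"
    using assms
    by (simp add: ip_self[symmetric] ip_add_left ip_add_right sqint_add ip_commute[of M g f])
  then show ?thesis
    by (simp add: ip_self complex_eq_iff)
qed

lemma nsq_scale: "nsq M (\<lambda>x. c * f x) = (cmod c)\<^sup>2 * nsq M f"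
  by (simp add: nsq_def norm_mult power_mult_distrib)

lemma nsq_diff:
  assumes "f \<in> sqint M" "g \<in> sqint M"
  shows "nsq M (\<lambda>x. f x - g x) = nsq M f - 2 * Re (ip M f g) + nsq M g"
  using nsq_add[OF assms(1) sqint_scale[OF assms(2), of "-1"]]
  using ip_scale_right[of M f "-1" g] nsq_scale[of M "-1" g] by simp

lemma ip_Cauchy_Schwarz:
  assumes f: "f \<in> sqint M" and g: "g \<in> sqint M"
  shows "(cmod (ip M f g))\<^sup>2 \<le> nsq M f * nsq M g"
proof (cases "nsq M g = 0")
  case False
  define a where "a = ip M f g / nsq M g"
  have pos: "nsq M g > 0" using False nsq_nonneg[of M g] by linarith
  have "0 \<le> nsq M (\<lambda>x. f x - a * g x)" by simp
  also have "\<dots> = nsq M f - 2 * Re (cnj a * ip M f g) + (cmod a)\<^sup>2 * nsq M g"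
    using nsq_diff[OF f sqint_scale[OF g, of a]] by (simp add: ip_scale_right nsq_scale)
  also have "cnj a * ip M f g = complex_of_real ((cmod (ip M f g))\<^sup>2 / nsq M g)"
    using complex_norm_square[of "ip M f g"] by (simp add: a_def mult.commute)
  also have "(cmod a)\<^sup>2 * nsq M g = (cmod (ip M f g))\<^sup>2 / nsq M g"
    using pos by (simp add: a_def norm_divide power_divide power2_eq_square)
  finally have "(cmod (ip M f g))\<^sup>2 / nsq M g \<le> nsq M f" by simp
  then show ?thesis using pos by (simp add: field_simps)
next
  case True
  have "AE x in M. (cmod (g x))\<^sup>2 = 0"
    using True sqint_integrable[OF g] integral_nonneg_eq_0_iff_AE[of M "\<lambda>x. (cmod (g x))\<^sup>2"]
    by (simp add: nsq_def)
  then have "ip M f g = 0"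
    unfolding ip_def by (intro integral_eq_zero_AE) (auto elim: eventually_mono)
  then show ?thesis by (simp add: True)
qed

lemma nsq_triangle:
  assumes f: "f \<in> sqint M" and g: "g \<in> sqint M"
  shows "sqrt (nsq M (\<lambda>x. f x + g x)) \<le> sqrt (nsq M f) + sqrt (nsq M g)"
proof (rule real_le_lsqrt)
  have "Re (ip M f g) \<le> cmod (ip M f g)" by (rule complex_Re_le_cmod)
  also have "\<dots> \<le> sqrt (nsq M f) * sqrt (nsq M g)"
    using ip_Cauchy_Schwarz[OF f g] by (simp add: real_le_rsqrt flip: real_sqrt_mult)
  finally show "nsq M (\<lambda>x. f x + g x) \<le> (sqrt (nsq M f) + sqrt (nsq M g))\<^sup>2"
    using nsq_add[OF f g] by (simp add: power2_sum)
qed simp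

section \<open>Trigonometric polynomials on the torus\<close>

definition wave :: "'a::euclidean_space \<Rightarrow> 'a \<Rightarrow> complex" where
  "wave x \<xi> = cis (2 * pi * (x \<bullet> \<xi>))"

definition lattice_pt :: "int \<times> int \<Rightarrow> real \<times> real" where
  "lattice_pt k = (of_int (fst k), of_int (snd k))"

lemma fourier_inv_wave: "fourier_inv g x = (\<integral>\<xi>. g \<xi> * wave x \<xi> \<partial>lborel)"
  by (simp add: fourier_inv_def wave_def)

lemma wave_add: "wave (x + y) \<xi> = wave x \<xi> * wave y \<xi>"
  by (simp add: wave_def cis_mult inner_add_left distrib_left)

lemma norm_wave [simp]: "cmod (wave x \<xi>) = 1"
  by (simp add: wave_def)

lemma cnj_wave: "cnj (wave x \<xi>) = wave (- x) \<xi>"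
  by (simp add: wave_def cis_cnj)

lemma continuous_on_wave [continuous_intros]:
  assumes "continuous_on S f"
  shows "continuous_on S (\<lambda>\<xi>. wave x (f \<xi>))"
  unfolding wave_def by (intro continuous_intros assms)

lemma lattice_pt_add: "lattice_pt (k + l) = lattice_pt k + lattice_pt l"
  by (simp add: lattice_pt_def)

lemma lattice_pt_minus: "lattice_pt (- k) = - lattice_pt k"
  by (simp add: lattice_pt_def)

text \<open>A polynomial in the coordinates of the torus is built by sums and products, so the generating rules
  are chosen to make closure under these a short induction; the coefficient form needed for
  orthogonal projection is recovered afterwards in \<open>trig_poly_sum\<close>.\<close>

inductive trig_poly :: "(real \<times> real \<Rightarrow> complex) \<Rightarrow> bool" where
  wave: "trig_poly (wave (lattice_pt k))"
| scale: "trig_poly p \<Longrightarrow> trig_poly (\<lambda>\<xi>. c * p \<xi>)"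
| add: "trig_poly p \<Longrightarrow> trig_poly q \<Longrightarrow> trig_poly (\<lambda>\<xi>. p \<xi> + q \<xi>)"

lemma trig_poly_const: "trig_poly (\<lambda>\<xi>. c)"
proof -
  have "wave (lattice_pt 0) = (\<lambda>\<xi>. 1)"
    by (simp add: lattice_pt_def wave_def fun_eq_iff flip: zero_prod_def)
  then show ?thesis
    using trig_poly.scale[OF trig_poly.wave[of 0], of c] by simp
qed

lemma trig_poly_wave_mult:
  "trig_poly p \<Longrightarrow> trig_poly (\<lambda>\<xi>. wave (lattice_pt k) \<xi> * p \<xi>)"
proof (induction rule: trig_poly.induct)
  case (wave l)
  then show ?case
    using trig_poly.wave[of "k + l"] by (simp add: lattice_pt_add wave_add[abs_def])
next
  case (scale p c)
  then show ?case
    using trig_poly.scale[OF scale.IH, of c] by (simp add: mult.left_commute)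
next
  case (add p q)
  then show ?case
    using trig_poly.add[OF add.IH] by (simp add: distrib_left)
qed

lemma trig_poly_mult:
  assumes "trig_poly p" "trig_poly q"
  shows "trig_poly (\<lambda>\<xi>. p \<xi> * q \<xi>)"
  using assms(1)
proof (induction rule: trig_poly.induct)
  case (wave k)
  then show ?case by (rule trig_poly_wave_mult[OF assms(2)])
next
  case (scale p c)
  then show ?case
    using trig_poly.scale[OF scale.IH, of c] by (simp add: mult.assoc)
next
  case (add p p')
  then show ?case
    using trig_poly.add[OF add.IH] by (simp add: distrib_right)
qed

text \<open>The frequencies carry a minus sign because the coefficient of \<open>G\<close> with respect to
  \<open>wave (- lattice_pt k)\<close> is then the inverse Fourier transform of \<open>G\<close> at the lattice point \<open>k\<close>.\<close>

lemma trig_poly_sum: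
  assumes "trig_poly p"
  shows "\<exists>K a. finite K \<and> p = (\<lambda>\<xi>. \<Sum>k\<in>K. a k * wave (- lattice_pt k) \<xi>)"
  using assms
proof (induction rule: trig_poly.induct)
  case (wave k)
  then show ?case
    by (intro exI[of _ "{- k}"] exI[of _ "\<lambda>_. 1"]) (simp add: lattice_pt_minus)
next
  case (scale p c)
  then obtain K a where "finite K" "p = (\<lambda>\<xi>. \<Sum>k\<in>K. a k * wave (- lattice_pt k) \<xi>)" by blast
  then show ?case
    by (intro exI[of _ K] exI[of _ "\<lambda>k. c * a k"]) (simp add: sum_distrib_left mult.assoc)
next
  case (add p q)
  then obtain K a L b where K: "finite K" "p = (\<lambda>\<xi>. \<Sum>k\<in>K. a k * wave (- lattice_pt k) \<xi>)"
    and L: "finite L" "q = (\<lambda>\<xi>. \<Sum>k\<in>L. b k * wave (- lattice_pt k) \<xi>)"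
    by blast
  have "(\<Sum>k\<in>K. a k * wave (- lattice_pt k) \<xi>)
      = (\<Sum>k\<in>K \<union> L. (if k \<in> K then a k else 0) * wave (- lattice_pt k) \<xi>)" for \<xi>
    using K(1) L(1) by (intro sum.mono_neutral_cong_left) auto
  moreover have "(\<Sum>k\<in>L. b k * wave (- lattice_pt k) \<xi>)
      = (\<Sum>k\<in>K \<union> L. (if k \<in> L then b k else 0) * wave (- lattice_pt k) \<xi>)" for \<xi>
    using K(1) L(1) by (intro sum.mono_neutral_cong_left) auto
  ultimately show ?case
    using K L
    by (intro exI[of _ "K \<union> L"]
          exI[of _ "\<lambda>k. (if k \<in> K then a k else 0) + (if k \<in> L then b k else 0)"])
       (simp add: sum.distrib distrib_right)
qed

lemma trig_poly_trigonometric: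
  shows "trig_poly (\<lambda>\<xi>. complex_of_real (cos (2 * pi * fst \<xi>)))"
    and "trig_poly (\<lambda>\<xi>. complex_of_real (sin (2 * pi * fst \<xi>)))"
    and "trig_poly (\<lambda>\<xi>. complex_of_real (cos (2 * pi * snd \<xi>)))"
    and "trig_poly (\<lambda>\<xi>. complex_of_real (sin (2 * pi * snd \<xi>)))"
proof -
  have *: "trig_poly (\<lambda>\<xi>. a * wave (lattice_pt k) \<xi> + b * wave (lattice_pt (- k)) \<xi>)" for a b k
    by (intro trig_poly.add trig_poly.scale trig_poly.wave)
  show "trig_poly (\<lambda>\<xi>. complex_of_real (cos (2 * pi * fst \<xi>)))"
    using *[of "1/2" "(1, 0)" "1/2"]
    by (rule back_subst[of trig_poly])
       (auto simp: fun_eq_iff wave_def lattice_pt_def complex_eq_iff inner_prod_def)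
  show "trig_poly (\<lambda>\<xi>. complex_of_real (sin (2 * pi * fst \<xi>)))"
    using *[of "- \<i>/2" "(1, 0)" "\<i>/2"]
    by (rule back_subst[of trig_poly])
       (auto simp: fun_eq_iff wave_def lattice_pt_def complex_eq_iff inner_prod_def)
  show "trig_poly (\<lambda>\<xi>. complex_of_real (cos (2 * pi * snd \<xi>)))"
    using *[of "1/2" "(0, 1)" "1/2"]
    by (rule back_subst[of trig_poly])
       (auto simp: fun_eq_iff wave_def lattice_pt_def complex_eq_iff inner_prod_def)
  show "trig_poly (\<lambda>\<xi>. complex_of_real (sin (2 * pi * snd \<xi>)))"
    using *[of "- \<i>/2" "(0, 1)" "\<i>/2"]
    by (rule back_subst[of trig_poly])
       (auto simp: fun_eq_iff wave_def lattice_pt_def complex_eq_iff inner_prod_def)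
qed

definition torus_pt :: "real \<times> real \<Rightarrow> complex \<times> complex" where
  "torus_pt \<xi> = (cis (2 * pi * fst \<xi>), cis (2 * pi * snd \<xi>))"

lemma trig_poly_real_polynomial:
  fixes r :: "complex \<times> complex \<Rightarrow> real"
  assumes "real_polynomial_function r"
  shows "trig_poly (\<lambda>\<xi>. complex_of_real (r (torus_pt \<xi>)))"
  using assms
proof (induction rule: real_polynomial_function.induct)
  case (linear r)
  interpret bounded_linear r by (rule linear)
  have "r (torus_pt \<xi>) = cos (2 * pi * fst \<xi>) * r (1, 0) + sin (2 * pi * fst \<xi>) * r (\<i>, 0)
      + (cos (2 * pi * snd \<xi>) * r (0, 1) + sin (2 * pi * snd \<xi>) * r (0, \<i>))" for \<xi>
  proof -
    have "torus_pt \<xi> = cos (2 * pi * fst \<xi>) *\<^sub>R (1, 0) + sin (2 * pi * fst \<xi>) *\<^sub>R (\<i>, 0)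
        + (cos (2 * pi * snd \<xi>) *\<^sub>R (0, 1) + sin (2 * pi * snd \<xi>) *\<^sub>R (0, \<i>))"
      by (simp add: torus_pt_def complex_eq_iff)
    then show ?thesis by (simp only: add scale real_scaleR_def)
  qed
  then have eq: "complex_of_real (r (torus_pt \<xi>))
      = r (1, 0) * complex_of_real (cos (2 * pi * fst \<xi>))
      + r (\<i>, 0) * complex_of_real (sin (2 * pi * fst \<xi>))
      + (r (0, 1) * complex_of_real (cos (2 * pi * snd \<xi>))
      + r (0, \<i>) * complex_of_real (sin (2 * pi * snd \<xi>)))" for \<xi>
    by (simp add: mult.commute)
  show ?case
    unfolding eq by (intro trig_poly.add trig_poly.scale trig_poly_trigonometric)
next
  case (const c)
  show ?case by (rule trig_poly_const)
next
  case (add f g)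
  then show ?case by (simp add: trig_poly.add)
next
  case (mult f g)
  then show ?case by (simp add: trig_poly_mult)
qed

text \<open>The point is approached from outside along its own ray, where \<open>G\<close> is 0.\<close>

lemma vanishes_on_boundary:
  fixes G :: "real \<times> real \<Rightarrow> complex"
  assumes cont: "continuous_on UNIV G"
    and supp: "\<And>\<xi>. \<bar>fst \<xi>\<bar> > c \<or> \<bar>snd \<xi>\<bar> > c \<Longrightarrow> G \<xi> = 0"
    and \<xi>: "\<bar>fst \<xi>\<bar> \<ge> c \<or> \<bar>snd \<xi>\<bar> \<ge> c" and c: "c > 0"
  shows "G \<xi> = 0"
proof (rule LIMSEQ_unique)
  define X where "X n = (1 + inverse (real (Suc n))) *\<^sub>R \<xi>" for n
  have "X \<longlonglongrightarrow> (1 + 0) *\<^sub>R \<xi>"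
    unfolding X_def by (intro tendsto_intros LIMSEQ_inverse_real_of_nat)
  then show "(\<lambda>n. G (X n)) \<longlonglongrightarrow> G \<xi>"
    using cont continuous_on_tendsto_compose[of UNIV G X \<xi> sequentially] by simp
  have "G (X n) = 0" for n
  proof (rule supp)
    have big: "\<bar>(1 + inverse (real (Suc n))) * t\<bar> > c" if "\<bar>t\<bar> \<ge> c" for t
    proof -
      have "inverse (real (Suc n)) * \<bar>t\<bar> > 0" using that c by (intro mult_pos_pos) auto
      then show ?thesis using that by (simp add: abs_mult distrib_right)
    qed
    show "c < \<bar>fst (X n)\<bar> \<or> c < \<bar>snd (X n)\<bar>"
      using \<xi> big by (auto simp: X_def)
  qed
  then show "(\<lambda>n. G (X n)) \<longlonglongrightarrow> 0" by simp
qed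

definition cell :: "(real \<times> real) set" where
  "cell = cbox (-1/2, -1/2) (1/2, 1/2)"

lemma cell_iff: "\<xi> \<in> cell \<longleftrightarrow> \<bar>fst \<xi>\<bar> \<le> 1/2 \<and> \<bar>snd \<xi>\<bar> \<le> 1/2"
  by (cases \<xi>) (auto simp: cell_def cbox_Pair_eq abs_le_iff)

text \<open>A function supported in the inner square \<open>[-1/4, 1/4]\<^sup>2\<close> transfers to a continuous function on the
  torus: the margin keeps the support away from the branch cut of \<open>Arg\<close>. Stone-Weierstrass
  approximates it there by a polynomial in real coordinates, which pulls back to a
  trigonometric polynomial.\<close>

lemma trig_poly_dense:
  fixes G :: "real \<times> real \<Rightarrow> complex"
  assumes cont: "continuous_on UNIV G"
    and supp: "\<And>\<xi>. \<bar>fst \<xi>\<bar> > 1/4 \<or> \<bar>snd \<xi>\<bar> > 1/4 \<Longrightarrow> G \<xi> = 0" and "e > 0"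
  shows "\<exists>p. trig_poly p \<and> (\<forall>\<xi>\<in>cell. cmod (G \<xi> - p \<xi>) < e)"
proof -
  define S where "S = sphere (0::complex) 1 \<times> sphere (0::complex) 1"
  define m where "m z = max (- Re (fst z)) (- Re (snd z))" for z :: "complex \<times> complex"
  define A where "A z = (Arg (fst z) / (2 * pi), Arg (snd z) / (2 * pi))" for z :: "complex \<times> complex"
  define H where "H z = (if m z \<le> 0 then G (A z) else 0)" for z
  have nonneg: False if "z \<in> \<real>\<^sub>\<le>\<^sub>0" "cmod z = 1" "Re z \<ge> 0" for z
    using that by (auto simp: complex_nonpos_Reals_iff cmod_def)
  \<comment> \<open>On the half-torus \<open>m z \<le> 0\<close> both real parts are nonnegative, so \<open>Arg\<close> is continuous; on the other half \<open>H\<close> is 0.\<close>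
  have "continuous_on S H"
    unfolding H_def
  proof (rule continuous_on_cases_le)
    have "continuous_on {z \<in> S. m z \<le> 0} A"
      unfolding A_def
      by (intro continuous_intros) (use nonneg in \<open>auto simp: S_def m_def\<close>)
    then show "continuous_on {z \<in> S. m z \<le> 0} (\<lambda>z. G (A z))"
      by (intro continuous_on_compose2[OF cont]) auto
    show "continuous_on S m"
      unfolding m_def by (intro continuous_intros)
    fix z assume z: "z \<in> S" "m z = 0"
    have "\<bar>Arg w\<bar> \<ge> pi / 2" if "w \<in> sphere 0 1" "Re w = 0" for w
      using Arg_Re_pos[of w] that by (auto simp: not_less[symmetric])
    then have "\<bar>Arg (fst z)\<bar> \<ge> pi / 2 \<or> \<bar>Arg (snd z)\<bar> \<ge> pi / 2"
      using z by (auto simp: S_def m_def max_def split: if_splits)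
    moreover have "\<bar>a / (2 * pi)\<bar> \<ge> 1/4" if "\<bar>a\<bar> \<ge> pi / 2" for a
      using that by (simp add: abs_divide pos_le_divide_eq)
    ultimately have "\<bar>fst (A z)\<bar> \<ge> 1/4 \<or> \<bar>snd (A z)\<bar> \<ge> 1/4"
      unfolding A_def fst_conv snd_conv by blast
    then show "G (A z) = 0"
      using vanishes_on_boundary[of G "1/4" "A z"] cont supp by simp
  qed simp
  moreover have "compact S"
    unfolding S_def by (intro compact_Times compact_sphere)
  ultimately obtain g where g: "polynomial_function g" "\<And>z. z \<in> S \<Longrightarrow> cmod (H z - g z) < e"
    using Stone_Weierstrass_polynomial_function[of S H e] \<open>e > 0\<close> by blast
  have "real_polynomial_function (Re \<circ> g)" "real_polynomial_function (Im \<circ> g)"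
    using g(1) bounded_linear_Re bounded_linear_Im by (auto simp: polynomial_function_def)
  then have "trig_poly (\<lambda>\<xi>. complex_of_real ((Re \<circ> g) (torus_pt \<xi>))
      + \<i> * complex_of_real ((Im \<circ> g) (torus_pt \<xi>)))"
    by (intro trig_poly.add trig_poly.scale trig_poly_real_polynomial)
  then have "trig_poly (\<lambda>\<xi>. g (torus_pt \<xi>))"
    by (simp add: complex_eq[symmetric])
  moreover have "cmod (G \<xi> - g (torus_pt \<xi>)) < e" if "\<xi> \<in> cell" for \<xi>
  proof -
    have b: "\<bar>fst \<xi>\<bar> \<le> 1/2" "\<bar>snd \<xi>\<bar> \<le> 1/2" using that by (auto simp: cell_iff)
    have "H (torus_pt \<xi>) = G \<xi>"
    proof (cases "\<bar>fst \<xi>\<bar> \<le> 1/4 \<and> \<bar>snd \<xi>\<bar> \<le> 1/4")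
      case True
      have arg: "Arg (cis (2 * pi * t)) = 2 * pi * t" if "\<bar>t\<bar> \<le> 1/4" for t
      proof (rule Arg_cis)
        have "\<bar>2 * pi * t\<bar> < pi" using that by (simp add: abs_mult)
        then show "2 * pi * t \<in> {- pi<..pi}" unfolding greaterThanAtMost_iff by linarith
      qed
      have cosp: "cos (2 * pi * t) \<ge> 0" if "\<bar>t\<bar> \<le> 1/4" for t
      proof (rule cos_ge_zero)
        have "\<bar>2 * pi * t\<bar> \<le> pi / 2" using that by (simp add: abs_mult)
        then show "- (pi / 2) \<le> 2 * pi * t" "2 * pi * t \<le> pi / 2" by linarith+
      qed
      show ?thesis
        using True by (auto simp: H_def m_def A_def torus_pt_def arg cosp)
    next
      case False
      have cosn: "cos (2 * pi * t) < 0" if "\<bar>t\<bar> \<le> 1/2" "\<not> \<bar>t\<bar> \<le> 1/4" for t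
      proof -
        have "2 * pi * \<bar>t\<bar> > pi / 2" "2 * pi * \<bar>t\<bar> \<le> pi" using that by auto
        then have "cos (2 * pi * \<bar>t\<bar>) < cos (pi / 2)"
          by (intro cos_monotone_0_pi) auto
        then show ?thesis by (cases "t \<ge> 0") auto
      qed
      have "m (torus_pt \<xi>) > 0"
        using False b cosn[of "fst \<xi>"] cosn[of "snd \<xi>"]
        unfolding m_def torus_pt_def less_max_iff_disj by auto
      then show ?thesis
        using False supp[of \<xi>] by (auto simp: H_def)
    qed
    moreover have "torus_pt \<xi> \<in> S" by (simp add: S_def torus_pt_def)
    ultimately show ?thesis using g(2)[of "torus_pt \<xi>"] by simp
  qed
  ultimately show ?thesis by blast
qed

section \<open>Parseval's identity for Fourier series\<close>

lemma integrable_mult_lborel_prod: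
  fixes f :: "'a::euclidean_space \<Rightarrow> complex" and g :: "'b::euclidean_space \<Rightarrow> complex"
  assumes f: "integrable lborel f" and g: "integrable lborel g"
  shows "integrable (lborel \<Otimes>\<^sub>M lborel) (\<lambda>x. f (fst x) * g (snd x))"
proof (rule lborel_pair.Fubini_integrable)
  have [measurable]: "f \<in> borel_measurable lborel" "g \<in> borel_measurable lborel"
    using f g by auto
  show "(\<lambda>x. f (fst x) * g (snd x)) \<in> borel_measurable (lborel \<Otimes>\<^sub>M lborel)"
    by measurable
  show "integrable lborel (\<lambda>x. \<integral>y. norm (f (fst (x, y)) * g (snd (x, y))) \<partial>lborel)"
    using f by (simp add: norm_mult)
  show "AE x in lborel. integrable lborel (\<lambda>y. f (fst (x, y)) * g (snd (x, y)))"
    using g by simp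
qed

lemma integral_mult_lborel_prod:
  fixes f :: "'a::euclidean_space \<Rightarrow> complex" and g :: "'b::euclidean_space \<Rightarrow> complex"
  assumes "integrable lborel f" "integrable lborel g"
  shows "(\<integral>x. f (fst x) * g (snd x) \<partial>lborel) = (\<integral>t. f t \<partial>lborel) * (\<integral>t. g t \<partial>lborel)"
  using lborel_pair.integral_fst'[OF integrable_mult_lborel_prod[OF assms]]
  by (simp add: lborel_prod)

lemma integral_cis_period:
  shows "integrable lborel (\<lambda>t. indicator {-1/2..1/2} t *\<^sub>R cis (2 * pi * (of_int k * t)))" (is ?int)
    and "(\<integral>t. indicator {-1/2..1/2} t *\<^sub>R cis (2 * pi * (of_int k * t)) \<partial>lborel) = of_bool (k = 0)" (is ?eq)
proof -
  let ?f = "\<lambda>t::real. cis (2 * pi * (of_int k * t))"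
  have cont: "continuous_on S ?f" for S by (intro continuous_intros)
  show ?int
    using borel_integrable_compact[of "{-1/2..1/2}" ?f] cont by simp
  show ?eq
  proof (cases "k = 0")
    case True
    then show ?thesis
      using integral_FTC_Icc[of "-1/2" "1/2" "\<lambda>t. complex_of_real t" "\<lambda>t. 1"]
      by (simp add: has_vector_derivative_def bounded_linear_imp_has_derivative scaleR_conv_of_real bounded_linear_of_real)
  next
    case False
    define c where "c = complex_of_real (2 * pi * of_int k) * \<i>"
    have c: "c \<noteq> 0" using False by (simp add: c_def)
    have f_exp: "?f t = exp (c * of_real t)" for t
      by (simp add: c_def cis_conv_exp mult_ac)
    have "((\<lambda>t. exp (c * of_real t) / c) has_vector_derivative ?f t) (at t within {-1/2..1/2})" for t
    proof -
      have "((\<lambda>z. exp (c * z) / c) has_field_derivative exp (c * of_real t)) (at (of_real t))"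
        using c by (auto intro!: derivative_eq_intros)
      from has_vector_derivative_real_field[OF this] show ?thesis by (simp add: f_exp)
    qed
    then have "(\<integral>t. indicator {-1/2..1/2} t *\<^sub>R ?f t \<partial>lborel)
        = exp (c * of_real (1/2)) / c - exp (c * of_real (-1/2)) / c"
      by (intro integral_FTC_Icc cont) auto
    also have "exp (c * of_real (1/2)) = exp (c * of_real (-1/2)) * exp c"
      by (simp flip: exp_add add: field_simps)
    also have "exp c = cis (2 * pi * of_int k)"
      by (simp add: c_def cis_conv_exp mult_ac)
    also have "\<dots> = 1" by (simp add: cis_multiple_2pi)
    finally show ?thesis using False by simp
  qed
qed

lemma integral_wave_cell:
  "(\<integral>\<xi>. indicator cell \<xi> *\<^sub>R wave (lattice_pt k) \<xi> \<partial>lborel) = of_bool (k = 0)"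
proof -
  have "indicator cell \<xi> *\<^sub>R wave (lattice_pt k) \<xi>
     = (indicator {-1/2..1/2} (fst \<xi>) *\<^sub>R cis (2 * pi * (of_int (fst k) * fst \<xi>)))
     * (indicator {-1/2..1/2} (snd \<xi>) *\<^sub>R cis (2 * pi * (of_int (snd k) * snd \<xi>)))" for \<xi>
  proof -
    have "indicator cell \<xi> = (indicator {-1/2..1/2} (fst \<xi>) * indicator {-1/2..1/2} (snd \<xi>) :: real)"
      by (cases \<xi>) (auto simp: cell_def cbox_Pair_eq indicator_def)
    moreover have "wave (lattice_pt k) \<xi> = cis (2 * pi * (of_int (fst k) * fst \<xi>))
        * cis (2 * pi * (of_int (snd k) * snd \<xi>))"
      by (simp add: wave_def lattice_pt_def inner_prod_def cis_mult distrib_left)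
    ultimately show ?thesis by simp
  qed
  then show ?thesis
    by (simp only: integral_mult_lborel_prod[OF integral_cis_period(1) integral_cis_period(1)]
        integral_cis_period(2)) (simp add: prod_eq_iff)
qed

abbreviation cellM :: "(real \<times> real) measure" where
  "cellM \<equiv> restrict_space lborel cell"

lemma compact_cell: "compact cell"
  by (simp add: cell_def compact_cbox)

lemma cell_sets [measurable]: "cell \<in> sets borel"
  by (simp add: cell_def)

lemma integrable_cellM:
  fixes f :: "real \<times> real \<Rightarrow> 'b :: {banach, second_countable_topology}"
  assumes "continuous_on cell f"
  shows "integrable cellM f"
  using borel_integrable_compact[OF compact_cell assms]
  by (subst integrable_restrict_space) auto

lemma sqint_cellM:
  assumes "continuous_on UNIV f"
  shows "f \<in> sqint cellM"
proof -
  have *: "continuous_on cell f" using assms by (rule continuous_on_subset) simp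
  have "continuous_on cell (\<lambda>x. (cmod (f x))\<^sup>2)" by (intro continuous_intros *)
  then show ?thesis
    unfolding sqint_def using integrable_cellM[OF *] integrable_cellM by auto
qed

lemma wave_orthonormal:
  "ip cellM (wave (- lattice_pt k)) (wave (- lattice_pt l)) = of_bool (k = l)"
proof -
  have "ip cellM (wave (- lattice_pt k)) (wave (- lattice_pt l))
      = (\<integral>\<xi>. wave (lattice_pt (l - k)) \<xi> \<partial>cellM)"
    unfolding ip_def cnj_wave wave_add[symmetric]
    using lattice_pt_add[of l "- k"] by (simp add: lattice_pt_minus)
  also have "\<dots> = (\<integral>\<xi>. indicator cell \<xi> *\<^sub>R wave (lattice_pt (l - k)) \<xi> \<partial>lborel)"
    by (subst integral_restrict_space) auto
  also have "\<dots> = of_bool (k = l)" by (subst integral_wave_cell) auto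
  finally show ?thesis .
qed

text \<open>Completing the square: with \<open>a\<close> the Fourier coefficients this is Bessel's inequality, and with \<open>a\<close>
  the coefficients of a good approximation it bounds the coefficient sum from below. The two
  uses together give Parseval.\<close>

lemma nsq_diff_orthonormal_sum:
  assumes K: "finite K" and e: "\<And>k. e k \<in> sqint M" and G: "G \<in> sqint M"
    and on: "\<And>k l. ip M (e k) (e l) = of_bool (k = l)"
  shows "nsq M (\<lambda>x. G x - (\<Sum>k\<in>K. a k * e k x))
    = nsq M G - (\<Sum>k\<in>K. (cmod (ip M G (e k)))\<^sup>2) + (\<Sum>k\<in>K. (cmod (a k - ip M G (e k)))\<^sup>2)"
proof -
  let ?p = "\<lambda>x. \<Sum>k\<in>K. a k * e k x"
  have p: "?p \<in> sqint M" by (intro sqint_sum sqint_scale e)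
  have "complex_of_real (nsq M ?p) = (\<Sum>k\<in>K. a k * ip M (e k) ?p)"
    unfolding ip_self[symmetric] by (rule ip_sum_left[OF e p])
  also have "\<dots> = (\<Sum>k\<in>K. a k * cnj (a k))"
  proof (rule sum.cong)
    fix k assume "k \<in> K"
    have "ip M (e k) ?p = (\<Sum>l\<in>K. cnj (a l) * ip M (e k) (e l))"
      by (rule ip_sum_right[OF e e])
    also have "\<dots> = (\<Sum>l\<in>K. if k = l then cnj (a l) else 0)"
      by (intro sum.cong) (auto simp: on)
    also have "\<dots> = cnj (a k)" using K \<open>k \<in> K\<close> by (simp add: sum.delta')
    finally show "a k * ip M (e k) ?p = a k * cnj (a k)" by simp
  qed simp
  finally have "nsq M ?p = (\<Sum>k\<in>K. Re (a k * cnj (a k)))"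
    by (metis Re_complex_of_real Re_sum)
  moreover have "Re (ip M G ?p) = (\<Sum>k\<in>K. Re (cnj (a k) * ip M G (e k)))"
    by (simp add: ip_sum_right[OF e G])
  ultimately have "nsq M (\<lambda>x. G x - ?p x) = nsq M G
      + (\<Sum>k\<in>K. Re (a k * cnj (a k)) - 2 * Re (cnj (a k) * ip M G (e k)))"
    using nsq_diff[OF G p] by (simp add: sum_subtractf sum_distrib_left)
  also have "(\<lambda>k. Re (a k * cnj (a k)) - 2 * Re (cnj (a k) * ip M G (e k)))
      = (\<lambda>k. (cmod (a k - ip M G (e k)))\<^sup>2 - (cmod (ip M G (e k)))\<^sup>2)"
    by (simp only: cmod_power2) (simp add: fun_eq_iff power2_eq_square algebra_simps)
  finally show ?thesis by (simp add: sum_subtractf)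
qed

lemma nn_integral_count_space_eqI:
  fixes f :: "'i \<Rightarrow> real"
  assumes nonneg: "\<And>i. 0 \<le> f i"
    and upper: "\<And>K. finite K \<Longrightarrow> sum f K \<le> A"
    and lower: "\<And>e. e > 0 \<Longrightarrow> \<exists>K. finite K \<and> A - e \<le> sum f K"
  shows "(\<integral>\<^sup>+i. ennreal (f i) \<partial>count_space UNIV) = ennreal A"
proof -
  have sum: "f summable_on UNIV"
    using nonneg upper by (intro nonneg_bdd_above_summable_on bdd_aboveI[of _ A]) auto
  have "infsum f UNIV = A"
  proof (rule antisym)
    show "infsum f UNIV \<le> A"
      using upper by (intro infsum_le_finite_sums sum) auto
    show "A \<le> infsum f UNIV"
    proof (rule field_le_epsilon)
      fix e :: real assume "e > 0"
      then obtain K where "finite K" "A - e \<le> sum f K" using lower by blast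
      moreover have "sum f K \<le> infsum f UNIV"
        using \<open>finite K\<close> nonneg by (intro finite_sum_le_infsum sum) auto
      ultimately show "A \<le> infsum f UNIV + e" by linarith
    qed
  qed
  moreover have abs: "Infinite_Set_Sum.abs_summable_on f UNIV"
    unfolding abs_summable_equivalent[symmetric] using sum nonneg by simp
  ultimately show ?thesis
    using nn_integral_conv_infsetsum[OF abs] nonneg by (simp add: infsetsum_infsum)
qed

text \<open>A uniform approximation on a cell of area 1 is an approximation in \<open>L\<^sup>2\<close>, so the coefficient sums
  exhaust the energy.\<close>

lemma fourier_series_Parseval:
  assumes cont: "continuous_on UNIV G"
    and supp: "\<And>\<xi>. \<bar>fst \<xi>\<bar> > 1/4 \<or> \<bar>snd \<xi>\<bar> > 1/4 \<Longrightarrow> G \<xi> = 0"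
  shows "(\<integral>\<^sup>+k. ennreal ((cmod (fourier_inv G (lattice_pt k)))\<^sup>2) \<partial>count_space UNIV)
    = ennreal (nsq lborel G)"
proof -
  let ?e = "\<lambda>k. wave (- lattice_pt k)"
  have supp': "indicator cell \<xi> *\<^sub>R G \<xi> = G \<xi>" for \<xi>
    using supp[of \<xi>] by (auto simp: indicator_def cell_iff not_le)
  have nsq: "nsq cellM G = nsq lborel G"
  proof -
    have "nsq cellM G = (\<integral>\<xi>. indicator cell \<xi> *\<^sub>R (cmod (G \<xi>))\<^sup>2 \<partial>lborel)"
      unfolding nsq_def by (subst integral_restrict_space) auto
    also have "(\<lambda>\<xi>. indicator cell \<xi> *\<^sub>R (cmod (G \<xi>))\<^sup>2) = (\<lambda>\<xi>. (cmod (G \<xi>))\<^sup>2)"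
    proof
      show "indicator cell \<xi> *\<^sub>R (cmod (G \<xi>))\<^sup>2 = (cmod (G \<xi>))\<^sup>2" for \<xi>
        using supp'[of \<xi>] by (cases "\<xi> \<in> cell") auto
    qed
    finally show ?thesis by (simp add: nsq_def)
  qed
  have coeff: "ip cellM G (?e k) = fourier_inv G (lattice_pt k)" for k
  proof -
    have "ip cellM G (?e k) = (\<integral>\<xi>. indicator cell \<xi> *\<^sub>R (G \<xi> * wave (lattice_pt k) \<xi>) \<partial>lborel)"
      unfolding ip_def by (subst integral_restrict_space) (auto simp: cnj_wave)
    also have "(\<lambda>\<xi>. indicator cell \<xi> *\<^sub>R (G \<xi> * wave (lattice_pt k) \<xi>))
        = (\<lambda>\<xi>. G \<xi> * wave (lattice_pt k) \<xi>)"
      by (simp only: mult_scaleR_left[symmetric] supp')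
    finally show ?thesis by (simp add: fourier_inv_wave)
  qed
  have e: "?e k \<in> sqint cellM" for k
    by (intro sqint_cellM continuous_on_wave continuous_on_id)
  have G: "G \<in> sqint cellM" by (rule sqint_cellM[OF cont])
  note dist = nsq_diff_orthonormal_sum[OF _ e G wave_orthonormal, unfolded coeff nsq]
  show ?thesis
  proof (rule nn_integral_count_space_eqI)
    fix K :: "(int \<times> int) set" assume "finite K"
    have "0 \<le> nsq cellM (\<lambda>\<xi>. G \<xi> - (\<Sum>k\<in>K. fourier_inv G (lattice_pt k) * ?e k \<xi>))"
      by simp
    then show "(\<Sum>k\<in>K. (cmod (fourier_inv G (lattice_pt k)))\<^sup>2) \<le> nsq lborel G"
      unfolding dist[OF \<open>finite K\<close>] by simp
  next
    fix \<epsilon> :: real assume "\<epsilon> > 0"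
    then obtain p where p: "trig_poly p" "\<And>\<xi>. \<xi> \<in> cell \<Longrightarrow> cmod (G \<xi> - p \<xi>) < sqrt \<epsilon>"
      using trig_poly_dense[OF cont supp, of "sqrt \<epsilon>"] by auto
    obtain K a where K: "finite K" "p = (\<lambda>\<xi>. \<Sum>k\<in>K. a k * ?e k \<xi>)"
      using trig_poly_sum[OF p(1)] by blast
    have contp: "continuous_on UNIV p"
      unfolding K(2) by (intro continuous_intros)
    have "nsq cellM (\<lambda>\<xi>. G \<xi> - p \<xi>) \<le> (\<integral>\<xi>. \<epsilon> \<partial>cellM)"
      unfolding nsq_def
    proof (rule integral_mono)
      show "integrable cellM (\<lambda>\<xi>. (cmod (G \<xi> - p \<xi>))\<^sup>2)"
        by (intro integrable_cellM continuous_intros continuous_on_subset[OF cont]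
            continuous_on_subset[OF contp]) auto
      show "integrable cellM (\<lambda>\<xi>. \<epsilon>)" by (intro integrable_cellM continuous_intros)
      fix \<xi> assume "\<xi> \<in> space cellM"
      then have "cmod (G \<xi> - p \<xi>) \<le> sqrt \<epsilon>" using p(2)[of \<xi>] by (simp add: less_imp_le)
      then show "(cmod (G \<xi> - p \<xi>))\<^sup>2 \<le> \<epsilon>"
        using \<open>\<epsilon> > 0\<close> by (simp add: sqrt_ge_absD)
    qed
    also have "\<dots> = \<epsilon>"
      by (simp add: measure_restrict_space cell_def content_Pair)
    finally have "nsq cellM (\<lambda>\<xi>. G \<xi> - p \<xi>) \<le> \<epsilon>" .
    moreover have "0 \<le> (\<Sum>k\<in>K. (cmod (a k - fourier_inv G (lattice_pt k)))\<^sup>2)"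
      by (intro sum_nonneg) simp
    ultimately have "nsq lborel G - \<epsilon> \<le> (\<Sum>k\<in>K. (cmod (fourier_inv G (lattice_pt k)))\<^sup>2)"
      using dist[OF K(1), of a] unfolding K(2) by linarith
    then show "\<exists>K. finite K \<and> nsq lborel G - \<epsilon> \<le> (\<Sum>k\<in>K. (cmod (fourier_inv G (lattice_pt k)))\<^sup>2)"
      using K(1) by blast
  qed simp
qed

section \<open>Plancherel for continuous spectra of bounded support\<close>

text \<open>The spectra to which all Fourier analysis below is applied: their inverse transforms are the
  band-limited functions.\<close>

definition bandlim :: "(real \<times> real \<Rightarrow> complex) \<Rightarrow> bool" where
  "bandlim G \<longleftrightarrow> continuous_on UNIV G \<and> (\<exists>R. \<forall>\<xi>. \<bar>fst \<xi>\<bar> > R \<or> \<bar>snd \<xi>\<bar> > R \<longrightarrow> G \<xi> = 0)"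

lemma bandlimI:
  assumes "continuous_on UNIV G" "\<And>\<xi>. \<bar>fst \<xi>\<bar> > R \<or> \<bar>snd \<xi>\<bar> > R \<Longrightarrow> G \<xi> = 0"
  shows "bandlim G"
  using assms unfolding bandlim_def by blast

lemma bandlim_continuous: "bandlim G \<Longrightarrow> continuous_on UNIV G"
  by (simp add: bandlim_def)

lemma bandlim_measurable: "bandlim G \<Longrightarrow> G \<in> borel_measurable borel"
  using bandlim_continuous borel_measurable_continuous_onI by blast

lemma bandlim_mult_left:
  assumes "bandlim G" "continuous_on UNIV H"
  shows "bandlim (\<lambda>\<xi>. H \<xi> * G \<xi>)"
proof -
  obtain R where "\<And>\<xi>. \<bar>fst \<xi>\<bar> > R \<or> \<bar>snd \<xi>\<bar> > R \<Longrightarrow> G \<xi> = 0"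
    using assms(1) unfolding bandlim_def by blast
  then show ?thesis
    using assms(2) bandlim_continuous[OF assms(1)]
    by (intro bandlimI[of _ R] continuous_intros) auto
qed

lemma bandlim_mult_right:
  assumes "bandlim G" "continuous_on UNIV H"
  shows "bandlim (\<lambda>\<xi>. G \<xi> * H \<xi>)"
  using bandlim_mult_left[OF assms] by (simp add: mult.commute)

lemma bandlim_scale: "bandlim G \<Longrightarrow> bandlim (\<lambda>\<xi>. c * G \<xi>)"
  by (rule bandlim_mult_left) (auto intro: continuous_intros)

lemma bandlim_add:
  assumes "bandlim G" "bandlim H"
  shows "bandlim (\<lambda>\<xi>. G \<xi> + H \<xi>)"
proof -
  obtain R S where "\<And>\<xi>. \<bar>fst \<xi>\<bar> > R \<or> \<bar>snd \<xi>\<bar> > R \<Longrightarrow> G \<xi> = 0"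
    and "\<And>\<xi>. \<bar>fst \<xi>\<bar> > S \<or> \<bar>snd \<xi>\<bar> > S \<Longrightarrow> H \<xi> = 0"
    using assms unfolding bandlim_def by blast
  then show ?thesis
    using assms[THEN bandlim_continuous]
    by (intro bandlimI[of _ "max R S"] continuous_intros) auto
qed

lemma bandlim_sum:
  assumes "\<And>i. i \<in> I \<Longrightarrow> bandlim (G i)"
  shows "bandlim (\<lambda>\<xi>. \<Sum>i\<in>I. G i \<xi>)"
  using assms
proof (induction I rule: infinite_finite_induct)
  case (insert i I)
  then show ?case by (simp add: bandlim_add)
qed (auto intro!: bandlimI continuous_intros)

text \<open>The auxiliary \<open>g\<close> covers \<open>G\<close> itself as well as its squared modulus.\<close>

lemma bandlim_integrable_of_support:
  fixes g :: "real \<times> real \<Rightarrow> 'b :: {banach, second_countable_topology}"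
  assumes G: "bandlim G" and g: "continuous_on UNIV g" "\<And>\<xi>. G \<xi> = 0 \<Longrightarrow> g \<xi> = 0"
  shows "integrable lborel g"
proof -
  obtain R where R: "\<And>\<xi>. \<bar>fst \<xi>\<bar> > R \<or> \<bar>snd \<xi>\<bar> > R \<Longrightarrow> G \<xi> = 0"
    using G unfolding bandlim_def by blast
  define B where "B = cbox (-R, -R) (R, R)"
  have "integrable lborel (\<lambda>\<xi>. indicator B \<xi> *\<^sub>R g \<xi>)"
    unfolding B_def by (intro borel_integrable_compact compact_cbox continuous_on_subset[OF g(1)]) auto
  moreover have "(\<lambda>\<xi>. indicator B \<xi> *\<^sub>R g \<xi>) = g"
  proof
    fix \<xi>
    have "\<xi> \<in> B \<or> G \<xi> = 0"
    proof (cases "\<bar>fst \<xi>\<bar> > R \<or> \<bar>snd \<xi>\<bar> > R")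
      case False
      then show ?thesis by (cases \<xi>) (auto simp: B_def cbox_Pair_eq abs_le_iff not_less)
    qed (simp add: R)
    then show "indicator B \<xi> *\<^sub>R g \<xi> = g \<xi>" using g(2)[of \<xi>] by auto
  qed
  ultimately show ?thesis by simp
qed

lemma bandlim_integrable: "bandlim G \<Longrightarrow> integrable lborel G"
  by (rule bandlim_integrable_of_support[of G]) (auto simp: bandlim_continuous)

lemma bandlim_sqint: "bandlim G \<Longrightarrow> G \<in> sqint lborel"
  unfolding sqint_def using bandlim_measurable[of G]
  by (auto intro!: bandlim_integrable_of_support[of G] continuous_intros bandlim_continuous)

lemma continuous_on_wave_id: "continuous_on S (wave x)"
  unfolding wave_def by (intro continuous_intros)

lemma bandlim_wave: "bandlim G \<Longrightarrow> bandlim (\<lambda>\<xi>. G \<xi> * wave x \<xi>)"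
  by (intro bandlim_mult_right continuous_on_wave_id)

lemma fourier_inv_add:
  assumes "bandlim G" "bandlim H"
  shows "fourier_inv (\<lambda>\<xi>. G \<xi> + H \<xi>) x = fourier_inv G x + fourier_inv H x"
  using assms by (simp add: fourier_inv_wave distrib_right bandlim_integrable bandlim_wave)

lemma fourier_inv_scale: "fourier_inv (\<lambda>\<xi>. c * G \<xi>) x = c * fourier_inv G x"
  by (simp add: fourier_inv_wave mult.assoc)

lemma fourier_inv_sum:
  assumes "\<And>i. i \<in> I \<Longrightarrow> bandlim (G i)"
  shows "fourier_inv (\<lambda>\<xi>. \<Sum>i\<in>I. c i * G i \<xi>) x = (\<Sum>i\<in>I. c i * fourier_inv (G i) x)"
  using assms
proof (induction I rule: infinite_finite_induct)
  case (insert i I)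
  then show ?case
    by (simp add: fourier_inv_add bandlim_scale bandlim_sum fourier_inv_scale)
qed (auto simp: fourier_inv_def)

lemma fourier_inv_modulate: "fourier_inv (\<lambda>\<xi>. G \<xi> * wave x \<xi>) y = fourier_inv G (x + y)"
  by (simp add: fourier_inv_wave wave_add mult.assoc)

lemma fourier_inv_measurable:
  assumes "bandlim G"
  shows "fourier_inv G \<in> borel_measurable borel"
proof -
  have [measurable]: "G \<in> borel_measurable borel" by (rule bandlim_measurable[OF assms])
  have [measurable]: "cis \<in> borel_measurable borel"
    by (intro borel_measurable_continuous_onI continuous_intros)
  have "(\<lambda>(x, \<xi>). G \<xi> * cis (2 * pi * (x \<bullet> \<xi>))) \<in> borel_measurable (borel \<Otimes>\<^sub>M lborel)"
    by measurable
  then show ?thesis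
    unfolding fourier_inv_def by (rule lborel.borel_measurable_lebesgue_integral)
qed

lemma integral_lborel_scale:
  fixes f :: "real \<times> real \<Rightarrow> 'b :: {banach, second_countable_topology}"
  assumes [measurable]: "f \<in> borel_measurable borel" and "c > 0"
  shows "(\<integral>x. f (c *\<^sub>R x) \<partial>lborel) = (1 / c\<^sup>2) *\<^sub>R (\<integral>x. f x \<partial>lborel)"
proof -
  have "(\<integral>x. f x \<partial>lborel)
      = (\<integral>x. f x \<partial>density (distr lborel borel (\<lambda>x. 0 + c *\<^sub>R x)) (\<lambda>_. ennreal (\<bar>c\<bar>^DIM(real \<times> real))))"
    using \<open>c > 0\<close> by (subst lborel_affine[of c 0]) auto
  also have "\<dots> = c\<^sup>2 *\<^sub>R (\<integral>x. f (c *\<^sub>R x) \<partial>lborel)"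
    by (subst integral_density) (auto simp: integral_distr power2_eq_square)
  finally show ?thesis using \<open>c > 0\<close> by simp
qed

text \<open>Band-limiting to a square of side \<open>s / 2\<close> makes the samples on the lattice of mesh \<open>1 / s\<close> determine
  the energy: this is \<open>fourier_series_Parseval\<close> after a dilation.\<close>

lemma Parseval_scaled:
  assumes cont: "continuous_on UNIV G" and s: "s > 0"
    and supp: "\<And>\<xi>. \<bar>fst \<xi>\<bar> > s/4 \<or> \<bar>snd \<xi>\<bar> > s/4 \<Longrightarrow> G \<xi> = 0"
  shows "(\<integral>\<^sup>+k. ennreal ((cmod (fourier_inv G (lattice_pt k /\<^sub>R s)))\<^sup>2) \<partial>count_space UNIV)
    = ennreal (s\<^sup>2 * nsq lborel G)"
proof -
  define H where "H \<eta> = G (s *\<^sub>R \<eta>)" for \<eta>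
  have [measurable]: "G \<in> borel_measurable borel"
    by (rule borel_measurable_continuous_onI[OF cont])
  have mw [measurable]: "wave x \<in> borel_measurable borel" for x :: "real \<times> real"
    by (intro borel_measurable_continuous_onI continuous_on_wave_id)
  have "continuous_on UNIV H"
    unfolding H_def by (intro continuous_on_compose2[OF cont] continuous_intros) auto
  moreover have "H \<eta> = 0" if "\<bar>fst \<eta>\<bar> > 1/4 \<or> \<bar>snd \<eta>\<bar> > 1/4" for \<eta>
    unfolding H_def using that s by (intro supp) (auto simp: abs_mult)
  ultimately have P: "(\<integral>\<^sup>+k. ennreal ((cmod (fourier_inv H (lattice_pt k)))\<^sup>2) \<partial>count_space UNIV)
    = ennreal (nsq lborel H)"
    by (rule fourier_series_Parseval)
  have "fourier_inv H y = (1 / s\<^sup>2) *\<^sub>R fourier_inv G (y /\<^sub>R s)" for y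
  proof -
    have "wave y \<eta> = wave (y /\<^sub>R s) (s *\<^sub>R \<eta>)" for \<eta>
      using s by (simp add: wave_def field_simps)
    then have "fourier_inv H y = (\<integral>\<eta>. G (s *\<^sub>R \<eta>) * wave (y /\<^sub>R s) (s *\<^sub>R \<eta>) \<partial>lborel)"
      by (simp add: fourier_inv_wave H_def)
    also have "\<dots> = (1 / s\<^sup>2) *\<^sub>R fourier_inv G (y /\<^sub>R s)"
      unfolding fourier_inv_wave
      using integral_lborel_scale[of "\<lambda>\<xi>. G \<xi> * wave (y /\<^sub>R s) \<xi>" s] s by simp
    finally show ?thesis .
  qed
  then have "(cmod (fourier_inv H y))\<^sup>2 = (cmod (fourier_inv G (y /\<^sub>R s)))\<^sup>2 / s^4" for y
    using s by (simp add: power_divide power_mult[symmetric])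
  moreover have "nsq lborel H = nsq lborel G / s\<^sup>2"
    unfolding nsq_def H_def
    using integral_lborel_scale[of "\<lambda>\<xi>. (cmod (G \<xi>))\<^sup>2" s] s by simp
  ultimately have P': "(\<integral>\<^sup>+k. ennreal ((cmod (fourier_inv G (lattice_pt k /\<^sub>R s)))\<^sup>2 / s^4) \<partial>count_space UNIV)
    = ennreal (nsq lborel G / s\<^sup>2)"
    using P by simp
  have "(\<integral>\<^sup>+k. ennreal ((cmod (fourier_inv G (lattice_pt k /\<^sub>R s)))\<^sup>2) \<partial>count_space UNIV)
    = (\<integral>\<^sup>+k. ennreal (s^4) * ennreal ((cmod (fourier_inv G (lattice_pt k /\<^sub>R s)))\<^sup>2 / s^4) \<partial>count_space UNIV)"
    using s by (intro nn_integral_cong) (simp flip: ennreal_mult)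
  also have "\<dots> = ennreal (s^4) * ennreal (nsq lborel G / s\<^sup>2)"
    by (subst nn_integral_cmult) (simp_all add: P')
  also have "\<dots> = ennreal (s\<^sup>2 * nsq lborel G)"
    using s by (simp flip: ennreal_mult add: power_numeral_reduce)
  finally show ?thesis .
qed

lemma sqintI_nn_integral:
  assumes "f \<in> borel_measurable M" "A \<ge> 0"
    and "(\<integral>\<^sup>+x. ennreal ((cmod (f x))\<^sup>2) \<partial>M) = ennreal A"
  shows "f \<in> sqint M" "nsq M f = A"
proof -
  have m: "(\<lambda>x. (cmod (f x))\<^sup>2) \<in> borel_measurable M"
    using assms(1) by simp
  show "f \<in> sqint M"
    unfolding sqint_def using assms m by (auto intro!: integrableI_nn_integral_finite[where x = A])
  show "nsq M f = A"
    unfolding nsq_def using assms m by (intro integral_eq_nn_integral[THEN trans]) auto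
qed

text \<open>Translating by \<open>x\<close> modulates the spectrum and leaves its energy alone, so the samples on every
  translate of the lattice have the same energy \<open>s\<^sup>2 * nsq lborel G\<close>. Averaging over the translates in
  one lattice cell, whose area is \<open>1 / s\<^sup>2\<close>, gives the integral over the plane.\<close>

lemma Plancherel_nn_integral:
  assumes G: "bandlim G"
  shows "(\<integral>\<^sup>+x. ennreal ((cmod (fourier_inv G x))\<^sup>2) \<partial>lborel) = ennreal (nsq lborel G)"
proof -
  obtain R where R: "\<And>\<xi>. \<bar>fst \<xi>\<bar> > R \<or> \<bar>snd \<xi>\<bar> > R \<Longrightarrow> G \<xi> = 0"
    using G unfolding bandlim_def by blast
  \<comment> \<open>The factor 4 puts the support of \<open>G\<close> into the square of half-width \<open>s / 4\<close>; the \<open>max\<close> makes \<open>s\<close> positive.\<close>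
  define s where "s = 4 * max R 1"
  have s: "s > 0" "s / 4 \<ge> R" by (auto simp: s_def)
  define U where "U x = ennreal ((cmod (fourier_inv G x))\<^sup>2)" for x
  define D where "D = {0..<1/s} \<times> {0..<1/s}"
  have [measurable]: "U \<in> borel_measurable borel"
    using fourier_inv_measurable[OF G] unfolding U_def by measurable
  have [measurable]: "D \<in> sets borel"
    unfolding D_def by (intro borel_Times) auto
  have tile: "x - lattice_pt k /\<^sub>R s \<in> D \<longleftrightarrow> k = (\<lfloor>s * fst x\<rfloor>, \<lfloor>s * snd x\<rfloor>)" for x k
  proof -
    have *: "0 \<le> t - of_int n / s \<and> t - of_int n / s < 1 / s \<longleftrightarrow> n = \<lfloor>s * t\<rfloor>" for t n
    proof -
      have "t - of_int n / s < 1 / s \<longleftrightarrow> t < (of_int n + 1) / s"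
        by (auto simp: add_divide_distrib)
      then have "t - of_int n / s < 1 / s \<longleftrightarrow> s * t < of_int n + 1" "0 \<le> t - of_int n / s \<longleftrightarrow> of_int n \<le> s * t"
        using s(1) by (simp_all add: pos_less_divide_eq pos_divide_le_eq mult.commute)
      then show ?thesis by (auto simp: floor_eq_iff eq_commute[of n])
    qed
    show ?thesis
      using *[of "fst x" "fst k"] *[of "snd x" "snd k"]
      by (simp add: D_def lattice_pt_def mem_Times_iff prod_eq_iff divide_inverse mult.commute[of _ "inverse s"])
  qed
  have "(\<integral>\<^sup>+x. U x \<partial>lborel)
      = (\<integral>\<^sup>+x. \<integral>\<^sup>+k. U x * indicator D (x - lattice_pt k /\<^sub>R s) \<partial>count_space UNIV \<partial>lborel)"
  proof (rule nn_integral_cong)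
    fix x
    have "(\<integral>\<^sup>+k. U x * indicator D (x - lattice_pt k /\<^sub>R s) \<partial>count_space UNIV)
       = (\<Sum>k\<in>{(\<lfloor>s * fst x\<rfloor>, \<lfloor>s * snd x\<rfloor>)}. U x * indicator D (x - lattice_pt k /\<^sub>R s))"
      by (rule nn_integral_count_space') (auto simp: tile)
    then show "U x = (\<integral>\<^sup>+k. U x * indicator D (x - lattice_pt k /\<^sub>R s) \<partial>count_space UNIV)"
      by (simp add: tile)
  qed
  also have "\<dots> = (\<integral>\<^sup>+k. \<integral>\<^sup>+x. U x * indicator D (x - lattice_pt k /\<^sub>R s) \<partial>lborel \<partial>count_space UNIV)"
    by (rule nn_integral_count_space_nn_integral) auto
  also have "\<dots> = (\<integral>\<^sup>+k. \<integral>\<^sup>+x. U (x + lattice_pt k /\<^sub>R s) * indicator D x \<partial>lborel \<partial>count_space UNIV)"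
  proof (rule nn_integral_cong)
    fix k
    have "(\<integral>\<^sup>+x. U x * indicator D (x - lattice_pt k /\<^sub>R s) \<partial>lborel)
      = (\<integral>\<^sup>+x. U x * indicator D (x - lattice_pt k /\<^sub>R s) \<partial>distr lborel borel ((+) (lattice_pt k /\<^sub>R s)))"
      by (simp add: lborel_distr_plus)
    also have "\<dots> = (\<integral>\<^sup>+x. U (x + lattice_pt k /\<^sub>R s) * indicator D x \<partial>lborel)"
      by (subst nn_integral_distr) (auto simp: add.commute)
    finally show "(\<integral>\<^sup>+x. U x * indicator D (x - lattice_pt k /\<^sub>R s) \<partial>lborel)
      = (\<integral>\<^sup>+x. U (x + lattice_pt k /\<^sub>R s) * indicator D x \<partial>lborel)" .
  qed
  also have "\<dots> = (\<integral>\<^sup>+x. \<integral>\<^sup>+k. U (x + lattice_pt k /\<^sub>R s) * indicator D x \<partial>count_space UNIV \<partial>lborel)"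
    by (rule nn_integral_count_space_nn_integral[symmetric]) auto
  also have "\<dots> = (\<integral>\<^sup>+x. ennreal (s\<^sup>2 * nsq lborel G) * indicator D x \<partial>lborel)"
  proof (rule nn_integral_cong)
    fix x
    have "(\<integral>\<^sup>+k. U (x + lattice_pt k /\<^sub>R s) \<partial>count_space UNIV)
      = ennreal (s\<^sup>2 * nsq lborel (\<lambda>\<xi>. G \<xi> * wave x \<xi>))"
      unfolding U_def fourier_inv_modulate[symmetric]
      using s R by (intro Parseval_scaled bandlim_continuous bandlim_wave G) auto
    also have "nsq lborel (\<lambda>\<xi>. G \<xi> * wave x \<xi>) = nsq lborel G"
      by (simp add: nsq_def norm_mult)
    finally show "(\<integral>\<^sup>+k. U (x + lattice_pt k /\<^sub>R s) * indicator D x \<partial>count_space UNIV)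
      = ennreal (s\<^sup>2 * nsq lborel G) * indicator D x"
      by (simp add: nn_integral_multc)
  qed
  also have "\<dots> = ennreal (s\<^sup>2 * nsq lborel G) * emeasure lborel D"
    by (simp add: nn_integral_cmult_indicator)
  also have "emeasure lborel D = ennreal (1 / s) * ennreal (1 / s)"
    unfolding D_def using s by (simp add: lborel_prod[symmetric] lborel.emeasure_pair_measure_Times)
  also have "ennreal (s\<^sup>2 * nsq lborel G) * (ennreal (1 / s) * ennreal (1 / s)) = ennreal (nsq lborel G)"
    using s by (simp flip: ennreal_mult add: power2_eq_square)
  finally show ?thesis by (simp add: U_def)
qed

lemma fourier_inv_sqint: "bandlim G \<Longrightarrow> fourier_inv G \<in> sqint lborel"
  using sqintI_nn_integral(1)[OF _ _ Plancherel_nn_integral] fourier_inv_measurable by simp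

lemma Plancherel_nsq: "bandlim G \<Longrightarrow> nsq lborel (fourier_inv G) = nsq lborel G"
  using sqintI_nn_integral(2)[OF _ _ Plancherel_nn_integral] fourier_inv_measurable by simp

lemma Plancherel_ip:
  assumes G: "bandlim G" and H: "bandlim H"
  shows "ip lborel (fourier_inv G) (fourier_inv H) = ip lborel G H"
proof -
  have Re: "Re (ip lborel (fourier_inv G) (fourier_inv H)) = Re (ip lborel G H)"
    if H: "bandlim H" for H
  proof -
    have "fourier_inv (\<lambda>\<xi>. G \<xi> + H \<xi>) = (\<lambda>x. fourier_inv G x + fourier_inv H x)"
      by (rule ext) (rule fourier_inv_add[OF G H])
    then show ?thesis using nsq_add[of "fourier_inv G" lborel "fourier_inv H"] nsq_add[of G lborel H]
      Plancherel_nsq[OF bandlim_add[OF G H]] G H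
      by (simp add: fourier_inv_sqint bandlim_sqint Plancherel_nsq)
  qed
  have "Im (ip lborel (fourier_inv G) (fourier_inv H)) = Im (ip lborel G H)"
    using Re[OF bandlim_scale[OF H, of \<i>]]
    by (simp add: fourier_inv_scale[abs_def] ip_scale_right)
  then show ?thesis using Re[OF H] by (simp add: complex_eq_iff)
qed

section \<open>The Meyer functions\<close>

text \<open>The scaling function \<open>phi_hat\<close> without its case distinction: the boundary values of \<open>\<nu>\<close> make
  the one formula cover the plateau and the region outside the support. This turns continuity of all
  windows into a routine matter.\<close>

definition cutoff :: "(real \<Rightarrow> real) \<Rightarrow> real \<Rightarrow> real" where
  "cutoff \<nu> t = cos (pi/2 * \<nu> (16 * \<bar>t\<bar> - 1))"

lemma smooth_continuous:
  assumes "smooth f"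
  shows "continuous_on UNIV f"
proof -
  have smooth: "((deriv ^^ n) f) differentiable (at x)" for n x
    using assms unfolding smooth_def by blast
  have "f differentiable (at x)" for x using smooth[of 0 x] by simp
  then show ?thesis
    by (simp add: continuous_at_imp_continuous_on differentiable_imp_continuous_within)
qed

lemma meyer_aux_continuous: "meyer_aux \<nu> \<Longrightarrow> continuous_on UNIV \<nu>"
  by (simp add: meyer_aux_def smooth_continuous)

lemma meyer_aux_le: "meyer_aux \<nu> \<Longrightarrow> x \<le> 0 \<Longrightarrow> \<nu> x = 0"
  by (simp add: meyer_aux_def)

lemma meyer_aux_ge: "meyer_aux \<nu> \<Longrightarrow> x \<ge> 1 \<Longrightarrow> \<nu> x = 1"
  by (simp add: meyer_aux_def)

lemma cutoff_inner: "meyer_aux \<nu> \<Longrightarrow> \<bar>t\<bar> \<le> 1/16 \<Longrightarrow> cutoff \<nu> t = 1"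
  by (simp add: cutoff_def meyer_aux_le)

lemma cutoff_outer: "meyer_aux \<nu> \<Longrightarrow> \<bar>t\<bar> \<ge> 1/8 \<Longrightarrow> cutoff \<nu> t = 0"
  by (simp add: cutoff_def meyer_aux_ge)

lemma phi_hat_eq_cutoff:
  assumes "meyer_aux \<nu>"
  shows "phi_hat \<nu> \<xi> = complex_of_real (cutoff \<nu> \<xi>)"
proof -
  consider "\<bar>\<xi>\<bar> \<le> 1/16" | "1/16 < \<bar>\<xi>\<bar>" "\<bar>\<xi>\<bar> \<le> 1/8" | "1/8 < \<bar>\<xi>\<bar>"
    by linarith
  then show ?thesis
  proof cases
    case 1
    then show ?thesis by (simp add: phi_hat_def cutoff_inner[OF assms])
  next
    case 2
    then show ?thesis by (simp add: phi_hat_def cutoff_def)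
  next
    case 3
    then show ?thesis by (simp add: phi_hat_def cutoff_outer[OF assms])
  qed
qed

text \<open>One of the two factors is constant 1 on each of the two rings where \<open>W\<close> lives, and one of them
  vanishes elsewhere; so the sine and the cosine piece merge into a product.\<close>

lemma W_eq:
  assumes \<nu>: "meyer_aux \<nu>"
  shows "W \<nu> \<xi> = cis (- 16 * pi * \<xi> / 3)
    * complex_of_real (sin (pi/2 * \<nu> (16 * \<bar>\<xi>\<bar> - 1)) * cutoff \<nu> (\<xi> / 2))"
proof -
  have c: "cutoff \<nu> (\<xi> / 2) = cos (pi/2 * \<nu> (8 * \<bar>\<xi>\<bar> - 1))"
    by (simp add: cutoff_def abs_divide)
  consider "\<bar>\<xi>\<bar> < 1/16" | "1/16 \<le> \<bar>\<xi>\<bar>" "\<bar>\<xi>\<bar> \<le> 1/8" | "1/8 < \<bar>\<xi>\<bar>" "\<bar>\<xi>\<bar> \<le> 1/4" | "1/4 < \<bar>\<xi>\<bar>"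
    by linarith
  then show ?thesis
  proof cases
    case 1
    then have "\<nu> (16 * \<bar>\<xi>\<bar> - 1) = 0" by (intro meyer_aux_le[OF \<nu>]) linarith
    moreover have "W \<nu> \<xi> = 0" unfolding W_def using 1 by (intro if_not_P[THEN trans] refl) linarith+
    ultimately show ?thesis by simp
  next
    case 2
    then have "\<nu> (8 * \<bar>\<xi>\<bar> - 1) = 0" by (intro meyer_aux_le[OF \<nu>]) linarith
    moreover have "W \<nu> \<xi> = cis (- 16 * pi * \<xi> / 3)
        * complex_of_real (sin (pi/2 * \<nu> (16 * \<bar>\<xi>\<bar> - 1)))"
      unfolding W_def using 2 by (intro if_P) simp
    ultimately show ?thesis by (simp only: c) simp
  next
    case 3
    then have "\<nu> (16 * \<bar>\<xi>\<bar> - 1) = 1" by (intro meyer_aux_ge[OF \<nu>]) linarith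
    moreover have "W \<nu> \<xi> = cis (- 16 * pi * \<xi> / 3)
        * complex_of_real (cos (pi/2 * \<nu> (8 * \<bar>\<xi>\<bar> - 1)))"
      unfolding W_def using 3 by (intro if_not_P[THEN trans] if_P) linarith+
    ultimately show ?thesis by (simp only: c) simp
  next
    case 4
    then have "\<nu> (8 * \<bar>\<xi>\<bar> - 1) = 1" by (intro meyer_aux_ge[OF \<nu>]) linarith
    moreover have "W \<nu> \<xi> = 0" unfolding W_def using 4 by (intro if_not_P[THEN trans] refl) linarith+
    ultimately show ?thesis by (simp only: c) simp
  qed
qed

lemma cutoff_square_le_1: "(cutoff \<nu> t)\<^sup>2 \<le> 1"
  by (simp add: cutoff_def abs_square_le_1)

lemma norm_phi_hat:
  assumes "meyer_aux \<nu>"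
  shows "(cmod (phi_hat \<nu> \<xi>))\<^sup>2 = (cutoff \<nu> \<xi>)\<^sup>2"
  by (simp add: phi_hat_eq_cutoff[OF assms])

text \<open>The squared wavelet window is a difference of squared cutoffs at consecutive scales. The mixed term
  simplifies because \<open>cutoff \<nu> (\<xi> / 2) = 1\<close> wherever \<open>cutoff \<nu> \<xi>\<close> is nonzero.\<close>

lemma norm_W:
  assumes \<nu>: "meyer_aux \<nu>"
  shows "(cmod (W \<nu> \<xi>))\<^sup>2 = (cutoff \<nu> (\<xi> / 2))\<^sup>2 - (cutoff \<nu> \<xi>)\<^sup>2"
proof -
  have "(cmod (W \<nu> \<xi>))\<^sup>2 = (1 - (cutoff \<nu> \<xi>)\<^sup>2) * (cutoff \<nu> (\<xi> / 2))\<^sup>2"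
    by (simp add: W_eq[OF \<nu>] norm_mult power_mult_distrib cutoff_def sin_squared_eq)
  also have "\<dots> = (cutoff \<nu> (\<xi> / 2))\<^sup>2 - (cutoff \<nu> \<xi>)\<^sup>2"
  proof (cases "\<bar>\<xi>\<bar> \<ge> 1/8")
    case True
    then show ?thesis by (simp add: cutoff_outer[OF \<nu>])
  next
    case False
    then have "cutoff \<nu> (\<xi> / 2) = 1" by (intro cutoff_inner[OF \<nu>]) auto
    then show ?thesis by simp
  qed
  finally show ?thesis .
qed

text \<open>As a bare introduction rule the conclusion would unify with any function, so this one is kept out of
  \<open>continuous_intros\<close>.\<close>

lemma continuous_on_meyer_aux:
  fixes f :: "'a::t2_space \<Rightarrow> real"
  assumes "meyer_aux \<nu>" "continuous_on S f"
  shows "continuous_on S (\<lambda>x. \<nu> (f x))"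
  using continuous_on_compose2[OF meyer_aux_continuous[OF assms(1)] assms(2)] by simp

lemma continuous_on_cutoff [continuous_intros]:
  fixes f :: "'a::t2_space \<Rightarrow> real"
  assumes "meyer_aux \<nu>" "continuous_on S f"
  shows "continuous_on S (\<lambda>x. cutoff \<nu> (f x))"
proof -
  have cont: "continuous_on S (\<lambda>x. \<nu> (16 * \<bar>f x\<bar> - 1))"
    by (rule continuous_on_meyer_aux[OF assms(1)]) (intro continuous_intros assms(2))
  show ?thesis
    unfolding cutoff_def by (intro continuous_intros cont)
qed

lemma continuous_on_phi_hat [continuous_intros]:
  fixes f :: "'a::t2_space \<Rightarrow> real"
  assumes "meyer_aux \<nu>" "continuous_on S f"
  shows "continuous_on S (\<lambda>x. phi_hat \<nu> (f x))"
  unfolding phi_hat_eq_cutoff[OF assms(1)] by (intro continuous_intros assms)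

lemma continuous_on_W [continuous_intros]:
  fixes f :: "'a::t2_space \<Rightarrow> real"
  assumes "meyer_aux \<nu>" "continuous_on S f"
  shows "continuous_on S (\<lambda>x. W \<nu> (f x))"
proof -
  have cont: "continuous_on S (\<lambda>x. \<nu> (16 * \<bar>f x\<bar> - 1))"
    by (rule continuous_on_meyer_aux[OF assms(1)]) (intro continuous_intros assms(2))
  show ?thesis
    unfolding W_eq[OF assms(1)] by (intro continuous_intros assms cont) auto
qed

lemma W2_components:
  "W2 \<nu> Ver \<xi> = phi_hat \<nu> (fst \<xi>) * W \<nu> (snd \<xi>)"
  "W2 \<nu> Hor \<xi> = W \<nu> (fst \<xi>) * phi_hat \<nu> (snd \<xi>)"
  "W2 \<nu> Dia \<xi> = W \<nu> (fst \<xi>) * W \<nu> (snd \<xi>)"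
  by (cases \<xi>; simp)+

lemma continuous_on_W2 [continuous_intros]:
  fixes f :: "'a::t2_space \<Rightarrow> real \<times> real"
  assumes "meyer_aux \<nu>" "continuous_on S f"
  shows "continuous_on S (\<lambda>x. W2 \<nu> \<iota> (f x))"
  by (cases \<iota>) (simp_all add: W2_components, (intro continuous_intros assms)+)

lemma W_support: "\<bar>t\<bar> > 1/4 \<Longrightarrow> W \<nu> t = 0"
  by (simp add: W_def)

lemma phi_hat_support: "\<bar>t\<bar> > 1/4 \<Longrightarrow> phi_hat \<nu> t = 0"
  by (simp add: phi_hat_def)

lemma W2_support: "\<bar>fst \<xi>\<bar> > 1/4 \<or> \<bar>snd \<xi>\<bar> > 1/4 \<Longrightarrow> W2 \<nu> \<iota> \<xi> = 0"
  by (cases \<iota>) (auto simp: W2_components W_support phi_hat_support)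

lemma W2_dilate_support:
  assumes "s > 0" "\<bar>fst \<xi>\<bar> > s / 4 \<or> \<bar>snd \<xi>\<bar> > s / 4"
  shows "W2 \<nu> \<iota> (\<xi> /\<^sub>R s) = 0"
proof (rule W2_support)
  have "\<bar>inverse s * t\<bar> > 1/4" if "\<bar>t\<bar> > s / 4" for t
    using that assms(1) by (simp add: abs_mult pos_less_divide_eq field_simps)
  then show "1/4 < \<bar>fst (\<xi> /\<^sub>R s)\<bar> \<or> 1/4 < \<bar>snd (\<xi> /\<^sub>R s)\<bar>"
    using assms(2) by auto
qed

definition cutoff2 :: "(real \<Rightarrow> real) \<Rightarrow> real \<times> real \<Rightarrow> real" where
  "cutoff2 \<nu> \<xi> = (cutoff \<nu> (fst \<xi>))\<^sup>2 * (cutoff \<nu> (snd \<xi>))\<^sup>2"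

text \<open>Writing \<open>a\<^sub>i\<close> and \<open>b\<^sub>i\<close> for the squared cutoffs of \<open>\<xi>\<^sub>i\<close> and \<open>\<xi>\<^sub>i / 2\<close>, the three orientations contribute
  \<open>a\<^sub>1 (b\<^sub>2 - a\<^sub>2) + (b\<^sub>1 - a\<^sub>1) a\<^sub>2 + (b\<^sub>1 - a\<^sub>1) (b\<^sub>2 - a\<^sub>2) = b\<^sub>1 b\<^sub>2 - a\<^sub>1 a\<^sub>2\<close>.\<close>

lemma sum_norm_W2:
  assumes "meyer_aux \<nu>"
  shows "(\<Sum>\<iota>\<in>{Hor, Ver, Dia}. (cmod (W2 \<nu> \<iota> \<xi>))\<^sup>2) = cutoff2 \<nu> (\<xi> /\<^sub>R 2) - cutoff2 \<nu> \<xi>"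
  by (simp add: W2_components norm_mult power_mult_distrib norm_W[OF assms] norm_phi_hat[OF assms]
      cutoff2_def algebra_simps)

lemma norm_W2_le_1:
  assumes "meyer_aux \<nu>"
  shows "cmod (W2 \<nu> \<iota> \<xi>) \<le> 1"
proof -
  have le: "cmod (W \<nu> t) \<le> 1" "cmod (phi_hat \<nu> t) \<le> 1" for t
  proof -
    have "(cmod (W \<nu> t))\<^sup>2 \<le> 1\<^sup>2"
      unfolding norm_W[OF assms] power_one
      using cutoff_square_le_1[of \<nu> "t/2"] zero_le_power2[of "cutoff \<nu> t"] by linarith
    then show "cmod (W \<nu> t) \<le> 1" by (rule power2_le_imp_le) simp
    have "(cmod (phi_hat \<nu> t))\<^sup>2 \<le> 1\<^sup>2"
      using cutoff_square_le_1[of \<nu> t] by (simp add: norm_phi_hat[OF assms])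
    then show "cmod (phi_hat \<nu> t) \<le> 1" by (rule power2_le_imp_le) simp
  qed
  show ?thesis
    by (cases \<iota>) (auto simp: W2_components norm_mult intro!: mult_le_one le)
qed

lemma sum_telescope_int:
  fixes f :: "int \<Rightarrow> 'a :: ab_group_add"
  assumes "m \<le> n"
  shows "(\<Sum>j\<in>{m..<n}. f (j + 1) - f j) = f n - f m"
  using assms
proof (induction n rule: int_ge_induct)
  case (step n)
  have "{m..<n + 1} = insert n {m..<n}" using step by auto
  then show ?case using step by simp
qed simp

lemma UNIV_orientation: "(UNIV :: orientation set) = {Hor, Ver, Dia}"
  using orientation.exhaust by auto

text \<open>By \<open>sum_norm_W2\<close> the sum over the scales telescopes. For a fixed \<open>\<xi> \<noteq> 0\<close> the two-dimensional
  cutoff at scale \<open>j\<close> is 1 for all large \<open>j\<close> and 0 for all very negative \<open>j\<close>, so only finitely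
  many terms survive and they add up to 1.\<close>

lemma sum_scales:
  assumes \<nu>: "meyer_aux \<nu>" and \<xi>: "\<xi> \<noteq> 0"
  shows "(\<integral>\<^sup>+j. ennreal (\<Sum>\<iota>\<in>{Hor, Ver, Dia}. (cmod (W2 \<nu> \<iota> (\<xi> /\<^sub>R 2 powi j)))\<^sup>2) \<partial>count_space UNIV) = 1"
proof -
  define P where "P j = cutoff2 \<nu> (\<xi> /\<^sub>R 2 powi j)" for j :: int
  define r where "r = max \<bar>fst \<xi>\<bar> \<bar>snd \<xi>\<bar>"
  have r: "r > 0"
  proof -
    have "fst \<xi> \<noteq> 0 \<or> snd \<xi> \<noteq> 0" using \<xi> by (simp add: prod_eq_iff)
    then show ?thesis unfolding r_def less_max_iff_disj by simp
  qed
  have powi_mono: "(2::real) powi i \<le> 2 powi j" if "i \<le> j" for i j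
    using that by (intro power_int_increasing) auto
  \<comment> \<open>The scales at which the cutoff has become 1 and 0 respectively.\<close>
  obtain n1 :: nat where n1: "16 * r < 2 ^ n1" using real_arch_pow[of 2 "16 * r"] by force
  obtain n2 :: nat where n2: "1 / (8 * r) < 2 ^ n2" using real_arch_pow[of 2 "1 / (8 * r)"] by force
  have pos: "\<bar>2 powi j\<bar> = (2 powi j :: real)" for j by simp
  have coord: "fst (\<xi> /\<^sub>R c) = fst \<xi> / c" "snd (\<xi> /\<^sub>R c) = snd \<xi> / c" for c
    by (simp_all add: divide_inverse)
  define M where "M = int (max n1 n2)"
  have hi: "P j = 1" if "j \<ge> M" for j
  proof -
    have "16 * r < 2 powi j"
    proof -
      have "int n1 \<le> j" using that by (simp add: M_def)
      then show ?thesis using n1 powi_mono[of "int n1" j] by simp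
    qed
    have small: "\<bar>t / 2 powi j\<bar> \<le> 1/16" if "\<bar>t\<bar> \<le> r" for t
    proof -
      have "\<bar>t\<bar> \<le> 1/16 * 2 powi j" using that \<open>16 * r < 2 powi j\<close> by linarith
      then have "\<bar>t\<bar> / 2 powi j \<le> 1/16" by (subst pos_divide_le_eq) simp_all
      then show ?thesis by (simp only: abs_divide pos)
    qed
    have "\<bar>fst (\<xi> /\<^sub>R 2 powi j)\<bar> \<le> 1/16" "\<bar>snd (\<xi> /\<^sub>R 2 powi j)\<bar> \<le> 1/16"
      unfolding coord by (rule small, simp add: r_def)+
    from this[THEN cutoff_inner[OF \<nu>]] show ?thesis
      unfolding P_def cutoff2_def by simp
  qed
  have lo: "P j = 0" if "j \<le> - M" for j
  proof -
    have "1 / (8 * r) < 2 powi (- j)"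
    proof -
      have "int n2 \<le> - j" using that by (simp add: M_def)
      then show ?thesis using n2 powi_mono[of "int n2" "- j"] by simp
    qed
    then have "1 < inverse (2 powi j) * (8 * r)"
      using r by (simp add: power_int_minus pos_divide_less_eq)
    then have "1/8 \<le> inverse (2 powi j) * r" by simp
    moreover have "\<bar>t / 2 powi j\<bar> = inverse (2 powi j) * r" if "\<bar>t\<bar> = r" for t
      unfolding abs_divide pos that by (rule divide_inverse_commute)
    moreover have "\<bar>fst \<xi>\<bar> = r \<or> \<bar>snd \<xi>\<bar> = r" unfolding r_def max_def by auto
    ultimately have "\<bar>fst (\<xi> /\<^sub>R 2 powi j)\<bar> \<ge> 1/8 \<or> \<bar>snd (\<xi> /\<^sub>R 2 powi j)\<bar> \<ge> 1/8"
      unfolding coord by metis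
    then have "cutoff \<nu> (fst (\<xi> /\<^sub>R 2 powi j)) = 0 \<or> cutoff \<nu> (snd (\<xi> /\<^sub>R 2 powi j)) = 0"
      using cutoff_outer[OF \<nu>] by blast
    then show ?thesis
      unfolding P_def cutoff2_def by auto
  qed
  have eq: "(\<Sum>\<iota>\<in>{Hor, Ver, Dia}. (cmod (W2 \<nu> \<iota> (\<xi> /\<^sub>R 2 powi j)))\<^sup>2) = P (j + 1) - P j" for j
  proof -
    have "\<xi> /\<^sub>R 2 powi j /\<^sub>R 2 = \<xi> /\<^sub>R 2 powi (j + 1)"
      by (simp add: power_int_add)
    then show ?thesis unfolding P_def by (simp only: sum_norm_W2[OF \<nu>])
  qed
  have mono: "0 \<le> P (j + 1) - P j" for j
    unfolding eq[symmetric] by (rule sum_nonneg) simp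
  have "(\<integral>\<^sup>+j. ennreal (P (j + 1) - P j) \<partial>count_space UNIV)
      = (\<Sum>j\<in>{- M - 1..<M}. ennreal (P (j + 1) - P j))"
  proof (rule nn_integral_count_space')
    fix j assume "j \<notin> {- M - 1..<M}"
    then consider "j \<ge> M" | "j < - M - 1" by force
    then show "ennreal (P (j + 1) - P j) = 0"
    proof cases
      case 1
      then show ?thesis using hi[of j] hi[of "j + 1"] by simp
    next
      case 2
      then show ?thesis using lo[of j] lo[of "j + 1"] by simp
    qed
  qed simp_all
  also have "\<dots> = ennreal (\<Sum>j\<in>{- M - 1..<M}. P (j + 1) - P j)"
    by (rule sum_ennreal) (rule mono)
  also have "(\<Sum>j\<in>{- M - 1..<M}. P (j + 1) - P j) = P M - P (- M - 1)"
    by (rule sum_telescope_int) (simp add: M_def)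
  also have "\<dots> = 1" using hi[of M] lo[of "- M - 1"] by simp
  finally show ?thesis unfolding eq by simp
qed

section \<open>The Meyer system as a Parseval frame\<close>

lemma psi_hat_eq:
  "psi_hat \<nu> (\<iota>, j, k) \<xi>
    = complex_of_real (2 powi (- j)) * W2 \<nu> \<iota> (\<xi> /\<^sub>R 2 powi j) * wave (- (lattice_pt k /\<^sub>R 2 powi j)) \<xi>"
proof -
  have "psi_hat \<nu> (\<iota>, j, k) \<xi> = complex_of_real (2 powi (- j)) * W2 \<nu> \<iota> (\<xi> /\<^sub>R 2 powi j)
      * cis (- 2 * pi * (lattice_pt k \<bullet> (\<xi> /\<^sub>R 2 powi j)))"
    by (cases k) (simp only: psi_hat.simps lattice_pt_def fst_conv snd_conv)
  then show ?thesis
    by (simp only: wave_def inner_minus_left inner_scaleR_left inner_scaleR_right) simp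
qed

lemma psi_hat_bandlim:
  assumes \<nu>: "meyer_aux \<nu>"
  shows "bandlim (psi_hat \<nu> l)"
proof -
  obtain \<iota> j k where l: "l = (\<iota>, j, k)" by (cases l) auto
  have "W2 \<nu> \<iota> (\<xi> /\<^sub>R 2 powi j) = 0" if "\<bar>fst \<xi>\<bar> > 2 powi j / 4 \<or> \<bar>snd \<xi>\<bar> > 2 powi j / 4" for \<xi>
    by (rule W2_dilate_support[OF _ that]) simp
  then have "bandlim (\<lambda>\<xi>. W2 \<nu> \<iota> (\<xi> /\<^sub>R 2 powi j))"
    by (intro bandlimI[of _ "2 powi j / 4"] continuous_intros \<nu>)
  then have "bandlim (\<lambda>\<xi>. psi_hat \<nu> (\<iota>, j, k) \<xi>)"
    unfolding psi_hat_eq by (intro bandlim_wave bandlim_scale)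
  then show ?thesis by (simp add: l)
qed

text \<open>At scale 0 the windows live in \<open>[-1/4, 1/4]\<^sup>2\<close> and the translations form the integer lattice, so the
  coefficients at one scale and orientation are lattice samples of a band-limited function, and
  \<open>Parseval_scaled\<close> sums them.\<close>

lemma sum_translates:
  assumes \<nu>: "meyer_aux \<nu>" and G: "bandlim G"
  shows "(\<integral>\<^sup>+k. ennreal ((cmod (ip lborel G (psi_hat \<nu> (\<iota>, j, k))))\<^sup>2) \<partial>count_space UNIV)
    = (\<integral>\<^sup>+\<xi>. ennreal ((cmod (G \<xi>))\<^sup>2 * (cmod (W2 \<nu> \<iota> (\<xi> /\<^sub>R 2 powi j)))\<^sup>2) \<partial>lborel)"
proof -
  define s where "s = (2::real) powi j"
  have s: "s > 0" by (simp add: s_def)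
  define H where "H \<xi> = G \<xi> * cnj (W2 \<nu> \<iota> (\<xi> /\<^sub>R s))" for \<xi>
  have H: "bandlim H"
    unfolding H_def by (intro bandlim_mult_right[OF G] continuous_intros \<nu>)
  have ip: "ip lborel G (psi_hat \<nu> (\<iota>, j, k)) = fourier_inv H (lattice_pt k /\<^sub>R s) / s" for k
  proof -
    have "ip lborel G (psi_hat \<nu> (\<iota>, j, k))
       = (\<integral>\<xi>. (H \<xi> * wave (lattice_pt k /\<^sub>R s) \<xi>) / s \<partial>lborel)"
      unfolding ip_def psi_hat_eq H_def s_def
      by (intro Bochner_Integration.integral_cong) (simp_all add: cnj_wave power_int_minus divide_inverse mult_ac)
    then show ?thesis by (simp add: fourier_inv_wave)
  qed
  have "(\<integral>\<^sup>+k. ennreal ((cmod (ip lborel G (psi_hat \<nu> (\<iota>, j, k))))\<^sup>2) \<partial>count_space UNIV)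
    = (\<integral>\<^sup>+k. ennreal (1 / s\<^sup>2) * ennreal ((cmod (fourier_inv H (lattice_pt k /\<^sub>R s)))\<^sup>2) \<partial>count_space UNIV)"
    using s by (intro nn_integral_cong) (simp add: ip norm_divide power_divide flip: ennreal_mult)
  also have "\<dots> = ennreal (1 / s\<^sup>2) * ennreal (s\<^sup>2 * nsq lborel H)"
  proof (subst nn_integral_cmult)
    have "H \<xi> = 0" if "\<bar>fst \<xi>\<bar> > s / 4 \<or> \<bar>snd \<xi>\<bar> > s / 4" for \<xi>
      by (simp add: H_def W2_dilate_support[OF s that])
    then show "ennreal (1 / s\<^sup>2)
        * (\<integral>\<^sup>+k. ennreal ((cmod (fourier_inv H (lattice_pt k /\<^sub>R s)))\<^sup>2) \<partial>count_space UNIV)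
        = ennreal (1 / s\<^sup>2) * ennreal (s\<^sup>2 * nsq lborel H)"
      by (subst Parseval_scaled[OF bandlim_continuous[OF H] s]) auto
  qed simp
  also have "\<dots> = ennreal (nsq lborel H)"
    using s by (simp flip: ennreal_mult)
  also have "\<dots> = (\<integral>\<^sup>+\<xi>. ennreal ((cmod (H \<xi>))\<^sup>2) \<partial>lborel)"
    unfolding nsq_def using sqint_integrable[OF bandlim_sqint[OF H]] by (simp add: nn_integral_eq_integral)
  finally show ?thesis by (simp add: H_def norm_mult power_mult_distrib s_def)
qed

text \<open>Sum \<open>sum_translates\<close> over orientations and scales and exchange the sums with the integral; the
  windows then form a partition of unity away from the origin by \<open>sum_scales\<close>.\<close>

lemma frame_identity_nn_integral:
  assumes \<nu>: "meyer_aux \<nu>" and G: "bandlim G"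
  shows "(\<integral>\<^sup>+l. ennreal ((cmod (ip lborel G (psi_hat \<nu> l)))\<^sup>2) \<partial>count_space UNIV) = ennreal (nsq lborel G)"
proof -
  let ?c = "\<lambda>l. ennreal ((cmod (ip lborel G (psi_hat \<nu> l)))\<^sup>2)"
  let ?w = "\<lambda>\<iota> j \<xi>. (cmod (W2 \<nu> \<iota> (\<xi> /\<^sub>R 2 powi j)))\<^sup>2"
  have [measurable]: "G \<in> borel_measurable borel" by (rule bandlim_measurable[OF G])
  have [measurable]: "?w \<iota> j \<in> borel_measurable borel" for \<iota> j
    by (intro borel_measurable_continuous_onI continuous_intros \<nu>)
  have "(\<integral>\<^sup>+l. ?c l \<partial>count_space UNIV)
      = (\<Sum>\<iota>\<in>{Hor, Ver, Dia}. \<integral>\<^sup>+j. \<integral>\<^sup>+k. ?c (\<iota>, j, k) \<partial>count_space UNIV \<partial>count_space UNIV)"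
    by (simp only: nn_integral_fst_count_space[symmetric, of ?c]
        nn_integral_fst_count_space[symmetric, of "\<lambda>y. ?c (_, y)"] UNIV_orientation)
       (simp add: nn_integral_count_space_finite)
  also have "\<dots> = (\<integral>\<^sup>+j. (\<Sum>\<iota>\<in>{Hor, Ver, Dia}. \<integral>\<^sup>+k. ?c (\<iota>, j, k) \<partial>count_space UNIV) \<partial>count_space UNIV)"
    by (rule nn_integral_sum[symmetric]) simp
  also have "\<dots> = (\<integral>\<^sup>+j. \<integral>\<^sup>+\<xi>. (\<Sum>\<iota>\<in>{Hor, Ver, Dia}. ennreal ((cmod (G \<xi>))\<^sup>2 * ?w \<iota> j \<xi>)) \<partial>lborel \<partial>count_space UNIV)"
    unfolding sum_translates[OF \<nu> G]
    by (intro nn_integral_cong nn_integral_sum[symmetric]) measurable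
  also have "\<dots> = (\<integral>\<^sup>+\<xi>. \<integral>\<^sup>+j. (\<Sum>\<iota>\<in>{Hor, Ver, Dia}. ennreal ((cmod (G \<xi>))\<^sup>2 * ?w \<iota> j \<xi>)) \<partial>count_space UNIV \<partial>lborel)"
    by (rule nn_integral_count_space_nn_integral[symmetric]) auto
  also have "\<dots> = (\<integral>\<^sup>+\<xi>. ennreal ((cmod (G \<xi>))\<^sup>2) \<partial>lborel)"
  proof (rule nn_integral_cong_AE)
    have "AE \<xi> in lborel. \<xi> \<noteq> (0 :: real \<times> real)" by (rule AE_lborel_singleton)
    then show "AE \<xi> in lborel. (\<integral>\<^sup>+j. (\<Sum>\<iota>\<in>{Hor, Ver, Dia}. ennreal ((cmod (G \<xi>))\<^sup>2 * ?w \<iota> j \<xi>)) \<partial>count_space UNIV)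
        = ennreal ((cmod (G \<xi>))\<^sup>2)"
    proof eventually_elim
      case (elim \<xi>)
      have "(\<integral>\<^sup>+j. (\<Sum>\<iota>\<in>{Hor, Ver, Dia}. ennreal ((cmod (G \<xi>))\<^sup>2 * ?w \<iota> j \<xi>)) \<partial>count_space UNIV)
        = (\<integral>\<^sup>+j. ennreal ((cmod (G \<xi>))\<^sup>2) * ennreal (\<Sum>\<iota>\<in>{Hor, Ver, Dia}. ?w \<iota> j \<xi>) \<partial>count_space UNIV)"
        by (intro nn_integral_cong)
          (simp add: sum_nonneg sum_distrib_left flip: ennreal_mult' sum_ennreal del: sum.insert)
      also have "\<dots> = ennreal ((cmod (G \<xi>))\<^sup>2) * 1"
        by (subst nn_integral_cmult, simp, subst sum_scales[OF \<nu> elim], rule refl)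
      finally show ?case by simp
    qed
  qed
  also have "\<dots> = ennreal (nsq lborel G)"
    unfolding nsq_def using sqint_integrable[OF bandlim_sqint[OF G]] by (simp add: nn_integral_eq_integral)
  finally show ?thesis .
qed

lemma has_sum_of_nn_integral_count_space:
  fixes f :: "'i \<Rightarrow> real"
  assumes "\<And>i. 0 \<le> f i" "0 \<le> A"
    and eq: "(\<integral>\<^sup>+i. ennreal (f i) \<partial>count_space UNIV) = ennreal A"
  shows "(f has_sum A) UNIV"
proof -
  have abs: "Infinite_Set_Sum.abs_summable_on f UNIV"
    unfolding Infinite_Set_Sum.abs_summable_on_def
    using assms by (intro integrableI_nn_integral_finite[where x = A]) auto
  have "ennreal (infsum f UNIV) = ennreal A"
    using nn_integral_conv_infsetsum[OF abs] assms by (simp add: infsetsum_infsum[OF abs])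
  then have "infsum f UNIV = A"
    using assms by (simp add: infsum_nonneg)
  moreover have "f summable_on UNIV"
    using abs[folded abs_summable_equivalent] assms(1) by simp
  ultimately show ?thesis using has_sum_infsum[of f UNIV] by simp
qed

lemma frame_identity:
  assumes "meyer_aux \<nu>" "bandlim G"
  shows "((\<lambda>l. (cmod (ip lborel G (psi_hat \<nu> l)))\<^sup>2) has_sum nsq lborel G) UNIV"
  by (rule has_sum_of_nn_integral_count_space[OF _ _ frame_identity_nn_integral[OF assms]]) simp_all

lemma psi_sqint: "meyer_aux \<nu> \<Longrightarrow> psi \<nu> l \<in> sqint lborel"
  unfolding psi_def by (rule fourier_inv_sqint[OF psi_hat_bandlim])

text \<open>Synthesis is the adjoint of analysis, so its norm bound follows from the frame identity for the
  single spectrum \<open>G\<close> of the sum itself: \<open>nsq G\<close> is a pairing of \<open>c\<close> with the coefficients of \<open>G\<close>, and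
  the latter have energy at most \<open>nsq G\<close>.\<close>

lemma synthesis_bound:
  assumes \<nu>: "meyer_aux \<nu>" and F: "finite F"
  shows "nsq lborel (\<lambda>x. \<Sum>l\<in>F. c l * psi \<nu> l x) \<le> (\<Sum>l\<in>F. (cmod (c l))\<^sup>2)"
proof -
  define G where "G \<xi> = (\<Sum>l\<in>F. c l * psi_hat \<nu> l \<xi>)" for \<xi>
  let ?d = "\<lambda>l. ip lborel G (psi_hat \<nu> l)"
  have G: "bandlim G"
    unfolding G_def by (intro bandlim_sum bandlim_scale psi_hat_bandlim[OF \<nu>])
  have "(\<lambda>x. \<Sum>l\<in>F. c l * psi \<nu> l x) = fourier_inv G"
    unfolding G_def psi_def by (rule ext, rule fourier_inv_sum[symmetric]) (rule psi_hat_bandlim[OF \<nu>])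
  then have "nsq lborel (\<lambda>x. \<Sum>l\<in>F. c l * psi \<nu> l x) = nsq lborel G"
    by (simp add: Plancherel_nsq[OF G])
  also have "\<dots> \<le> (\<Sum>l\<in>F. (cmod (c l))\<^sup>2)"
  proof -
    have "complex_of_real (nsq lborel G) = ip lborel G G" by (rule ip_self[symmetric])
    also have "\<dots> = (\<Sum>l\<in>F. cnj (c l) * ?d l)"
    proof -
      have "G = (\<lambda>\<xi>. \<Sum>l\<in>F. c l * psi_hat \<nu> l \<xi>)" by (rule ext) (rule G_def)
      then have "ip lborel G G = ip lborel G (\<lambda>\<xi>. \<Sum>l\<in>F. c l * psi_hat \<nu> l \<xi>)" by simp
      also have "\<dots> = (\<Sum>l\<in>F. cnj (c l) * ?d l)"
        by (rule ip_sum_right[OF bandlim_sqint[OF psi_hat_bandlim[OF \<nu>]] bandlim_sqint[OF G]])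
      finally show ?thesis .
    qed
    finally have "nsq lborel G = Re (\<Sum>l\<in>F. cnj (c l) * ?d l)"
      by (metis Re_complex_of_real)
    also have "\<dots> \<le> (\<Sum>l\<in>F. cmod (cnj (c l) * ?d l))"
      by (rule order_trans[OF complex_Re_le_cmod norm_sum])
    also have "\<dots> \<le> (\<Sum>l\<in>F. (cmod (c l))\<^sup>2 / 2 + (cmod (?d l))\<^sup>2 / 2)"
    proof (rule sum_mono)
      fix l
      show "cmod (cnj (c l) * ?d l) \<le> (cmod (c l))\<^sup>2 / 2 + (cmod (?d l))\<^sup>2 / 2"
        using sum_squares_bound[of "cmod (c l)" "cmod (?d l)"] by (simp add: norm_mult)
    qed
    also have "\<dots> = (\<Sum>l\<in>F. (cmod (c l))\<^sup>2) / 2 + (\<Sum>l\<in>F. (cmod (?d l))\<^sup>2) / 2"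
      by (simp add: sum.distrib sum_divide_distrib)
    finally have "nsq lborel G \<le> (\<Sum>l\<in>F. (cmod (c l))\<^sup>2) / 2 + (\<Sum>l\<in>F. (cmod (?d l))\<^sup>2) / 2" .
    moreover have "(\<Sum>l\<in>F. (cmod (?d l))\<^sup>2) \<le> nsq lborel G"
      by (rule finite_sum_le_has_sum[OF frame_identity[OF \<nu> G] F]) simp_all
    ultimately show ?thesis by linarith
  qed
  finally show ?thesis .
qed

text \<open>Expand the square and use \<open>synthesis_bound\<close>. Only finite combinations of wavelets enter, so this
  reaches the masked image, whose spectrum need not have bounded support; Bessel's inequality for it is
  an immediate consequence.\<close>

lemma analysis_synthesis_defect:
  assumes \<nu>: "meyer_aux \<nu>" and F: "finite F" and g: "g \<in> sqint lborel"
  shows "nsq lborel (\<lambda>x. g x - (\<Sum>l\<in>F. ip lborel g (psi \<nu> l) * psi \<nu> l x))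
    \<le> nsq lborel g - (\<Sum>l\<in>F. (cmod (ip lborel g (psi \<nu> l)))\<^sup>2)"
proof -
  let ?c = "\<lambda>l. ip lborel g (psi \<nu> l)"
  let ?S = "\<lambda>x. \<Sum>l\<in>F. ?c l * psi \<nu> l x"
  have S: "?S \<in> sqint lborel" by (intro sqint_sum sqint_scale psi_sqint \<nu>)
  have "ip lborel g ?S = (\<Sum>l\<in>F. cnj (?c l) * ?c l)"
    by (rule ip_sum_right[OF psi_sqint[OF \<nu>] g])
  also have "\<dots> = complex_of_real (\<Sum>l\<in>F. (cmod (?c l))\<^sup>2)"
    unfolding of_real_sum by (intro sum.cong refl) (simp only: complex_norm_square mult.commute)
  finally have "Re (ip lborel g ?S) = (\<Sum>l\<in>F. (cmod (?c l))\<^sup>2)" by simp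
  then show ?thesis
    using nsq_diff[OF g S] synthesis_bound[OF \<nu> F, of ?c] by linarith
qed

lemma Bessel:
  assumes "meyer_aux \<nu>" "finite F" "g \<in> sqint lborel"
  shows "(\<Sum>l\<in>F. (cmod (ip lborel g (psi \<nu> l)))\<^sup>2) \<le> nsq lborel g"
  using order_trans[OF nsq_nonneg analysis_synthesis_defect[OF assms]] by simp

section \<open>Hard thresholding\<close>

text \<open>Infinitely many coefficients above \<open>\<beta>\<close> would exceed every energy bound. Hence the synthesis series
  in the theorem is a finite sum.\<close>

lemma finite_thresh_set:
  assumes \<nu>: "meyer_aux \<nu>" and f: "f \<in> sqint lborel" and "\<beta> > 0"
  shows "finite (thresh_set \<nu> f \<beta>)"
proof (rule ccontr)
  assume "infinite (thresh_set \<nu> f \<beta>)"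
  obtain n :: nat where n: "nsq lborel f < real n * \<beta>\<^sup>2"
    using reals_Archimedean3[of "\<beta>\<^sup>2"] \<open>\<beta> > 0\<close> by auto
  obtain F where F: "F \<subseteq> thresh_set \<nu> f \<beta>" "finite F" "card F = n"
    using infinite_arbitrarily_large[OF \<open>infinite _\<close>] by blast
  have "real n * \<beta>\<^sup>2 = (\<Sum>l\<in>F. \<beta>\<^sup>2)" using F by simp
  also have "\<dots> \<le> (\<Sum>l\<in>F. (cmod (ip lborel f (psi \<nu> l)))\<^sup>2)"
    using F(1) \<open>\<beta> > 0\<close> by (intro sum_mono power_mono) (auto simp: thresh_set_def L2_inner_eq_ip)
  also have "\<dots> \<le> nsq lborel f" by (rule Bessel[OF \<nu> F(2) f])
  finally show False using n by simp
qed

lemma is_synthesis_finite: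
  assumes \<nu>: "meyer_aux \<nu>" and T: "finite T"
  shows "is_synthesis \<nu> (restrict_seq T c) (\<lambda>x. \<Sum>l\<in>T. c l * psi \<nu> l x)"
  unfolding is_synthesis_def
proof
  show "(\<lambda>x. \<Sum>l\<in>T. c l * psi \<nu> l x) \<in> L2"
    unfolding L2_eq_sqint by (intro sqint_sum sqint_scale psi_sqint \<nu>)
  have "eventually (\<lambda>F. finite F \<and> T \<subseteq> F) (finite_subsets_at_top (UNIV :: meyer_index set))"
    using T by (auto simp: eventually_finite_subsets_at_top)
  then have "eventually (\<lambda>F. L2_norm (\<lambda>x. (\<Sum>l\<in>F. restrict_seq T c l * psi \<nu> l x)
      - (\<Sum>l\<in>T. c l * psi \<nu> l x)) = 0) (finite_subsets_at_top UNIV)"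
  proof eventually_elim
    case (elim F)
    have "(\<Sum>l\<in>F. restrict_seq T c l * psi \<nu> l x) = (\<Sum>l\<in>T. c l * psi \<nu> l x)" for x
      using elim by (intro sum.mono_neutral_cong_right) (auto simp: restrict_seq_def)
    then show ?case by (simp add: L2_norm_def)
  qed
  then show "((\<lambda>F. L2_norm (\<lambda>x. (\<Sum>l\<in>F. restrict_seq T c l * psi \<nu> l x)
      - (\<Sum>l\<in>T. c l * psi \<nu> l x))) \<longlongrightarrow> 0) (finite_subsets_at_top UNIV)"
    by (rule tendsto_eventually)
qed

lemma psi_coefficient:
  assumes "meyer_aux \<nu>" "bandlim G"
  shows "ip lborel (fourier_inv G) (psi \<nu> l) = ip lborel G (psi_hat \<nu> l)"
  unfolding psi_def by (rule Plancherel_ip[OF assms(2) psi_hat_bandlim[OF assms(1)]])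

text \<open>Choose a finite set \<open>F\<close> of indices that carries all of the energy of \<open>g\<close> but 1, and \<open>\<beta>\<close> below
  every nonzero coefficient of \<open>f\<close> on \<open>F\<close>. An index of \<open>F\<close> is dropped only if the coefficient of
  \<open>f\<close> is 0 there, and then the coefficient of \<open>g\<close> is one of \<open>g - f\<close>; so thresholding loses at most
  \<open>nsq (f - g) + 1\<close> of the energy of \<open>g\<close>. Replacing the coefficients of \<open>g\<close> by those of \<open>f\<close> costs
  \<open>L2_norm (f - g)\<close> once more.\<close>

lemma thresholding_error:
  assumes \<nu>: "meyer_aux \<nu>" and f: "f \<in> sqint lborel" and G: "bandlim G"
  defines "g \<equiv> fourier_inv G"
  shows "\<exists>\<beta>>0. \<exists>L. is_synthesis \<nu> (restrict_seq (thresh_set \<nu> f \<beta>) (analysis_op \<nu> f)) L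
    \<and> L2_norm (\<lambda>x. L x - g x) \<le> 2 * L2_norm (\<lambda>x. f x - g x) + 1"
proof -
  let ?c = "\<lambda>l. ip lborel f (psi \<nu> l)" and ?d = "\<lambda>l. ip lborel g (psi \<nu> l)"
  define \<epsilon>2 where "\<epsilon>2 = nsq lborel (\<lambda>x. f x - g x)"
  have g: "g \<in> sqint lborel" unfolding g_def by (rule fourier_inv_sqint[OF G])
  have fg: "(\<lambda>x. f x - g x) \<in> sqint lborel" by (rule sqint_diff[OF f g])
  have cd: "ip lborel (\<lambda>x. f x - g x) (psi \<nu> l) = ?c l - ?d l" for l
    by (rule ip_diff_left[OF f g psi_sqint[OF \<nu>]])
  have "((\<lambda>l. (cmod (?d l))\<^sup>2) has_sum nsq lborel g) UNIV"
    unfolding g_def psi_coefficient[OF \<nu> G] Plancherel_nsq[OF G] by (rule frame_identity[OF \<nu> G])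
  then have "eventually (\<lambda>F. nsq lborel g - 1 < (\<Sum>l\<in>F. (cmod (?d l))\<^sup>2)) (finite_subsets_at_top UNIV)"
    unfolding has_sum_def by (rule order_tendstoD) simp
  then obtain F where F: "finite F" "nsq lborel g - 1 < (\<Sum>l\<in>F. (cmod (?d l))\<^sup>2)"
    unfolding eventually_finite_subsets_at_top by blast
  define F0 where "F0 = {l \<in> F. ?c l \<noteq> 0}"
  \<comment> \<open>The element 1 keeps the minimum defined when \<open>F0\<close> is empty.\<close>
  define \<beta> where "\<beta> = Min (insert 1 ((\<lambda>l. cmod (?c l)) ` F0))"
  define T where "T = thresh_set \<nu> f \<beta>"
  have F0: "finite F0" using F(1) by (simp add: F0_def)
  have \<beta>: "\<beta> > 0" unfolding \<beta>_def using F0 by (subst Min_gr_iff) (auto simp: F0_def)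
  have T: "finite T" unfolding T_def by (rule finite_thresh_set[OF \<nu> f \<beta>])
  have "F0 \<subseteq> T"
    using F0 by (auto simp: T_def thresh_set_def L2_inner_eq_ip \<beta>_def intro!: Min_le)
  have "(\<Sum>l\<in>F - F0. (cmod (?d l))\<^sup>2) = (\<Sum>l\<in>F - F0. (cmod (ip lborel (\<lambda>x. f x - g x) (psi \<nu> l)))\<^sup>2)"
    by (intro sum.cong) (auto simp: F0_def cd)
  also have "\<dots> \<le> \<epsilon>2"
    unfolding \<epsilon>2_def using F(1) by (intro Bessel[OF \<nu> _ fg]) simp
  finally have "(\<Sum>l\<in>F. (cmod (?d l))\<^sup>2) \<le> \<epsilon>2 + (\<Sum>l\<in>F0. (cmod (?d l))\<^sup>2)"
    using sum.subset_diff[of F0 F "\<lambda>l. (cmod (?d l))\<^sup>2"] F(1) by (simp add: F0_def)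
  also have "(\<Sum>l\<in>F0. (cmod (?d l))\<^sup>2) \<le> (\<Sum>l\<in>T. (cmod (?d l))\<^sup>2)"
    using \<open>F0 \<subseteq> T\<close> T by (intro sum_mono2) auto
  finally have tail: "nsq lborel g - (\<Sum>l\<in>T. (cmod (?d l))\<^sup>2) \<le> \<epsilon>2 + 1" using F(2) by linarith
  define L where "L x = (\<Sum>l\<in>T. ?c l * psi \<nu> l x)" for x
  \<comment> \<open>\<open>R\<close> synthesises the coefficients of \<open>f - g\<close>, and \<open>S\<close> is the part of \<open>g\<close> lost by thresholding; the error is \<open>R - S\<close>.\<close>
  define R where "R x = (\<Sum>l\<in>T. (?c l - ?d l) * psi \<nu> l x)" for x
  define S where "S x = g x - (\<Sum>l\<in>T. ?d l * psi \<nu> l x)" for x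
  have R: "R \<in> sqint lborel"
    unfolding R_def by (intro sqint_sum sqint_scale psi_sqint \<nu>)
  have S: "S \<in> sqint lborel"
    unfolding S_def by (intro sqint_diff g sqint_sum sqint_scale psi_sqint \<nu>)
  have "nsq lborel R \<le> (\<Sum>l\<in>T. (cmod (?c l - ?d l))\<^sup>2)"
    unfolding R_def by (rule synthesis_bound[OF \<nu> T])
  also have "\<dots> \<le> \<epsilon>2"
    unfolding \<epsilon>2_def cd[symmetric] by (rule Bessel[OF \<nu> T fg])
  finally have R_le: "sqrt (nsq lborel R) \<le> sqrt \<epsilon>2" by simp
  have "nsq lborel S \<le> \<epsilon>2 + 1"
    using analysis_synthesis_defect[OF \<nu> T g] tail unfolding S_def by linarith
  then have "sqrt (nsq lborel S) \<le> sqrt (\<epsilon>2 + 1)" by simp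
  also have "\<dots> \<le> sqrt \<epsilon>2 + sqrt 1"
    by (rule sqrt_add_le_add_sqrt) (simp_all add: \<epsilon>2_def)
  finally have S_le: "sqrt (nsq lborel S) \<le> sqrt \<epsilon>2 + 1" by simp
  have "L x - g x = R x + (- 1) * S x" for x
    by (simp add: L_def R_def S_def left_diff_distrib sum_subtractf)
  then have "L2_norm (\<lambda>x. L x - g x) = sqrt (nsq lborel (\<lambda>x. R x + (- 1) * S x))"
    by (simp only: L2_norm_eq_nsq)
  also have "\<dots> \<le> sqrt (nsq lborel R) + sqrt (nsq lborel (\<lambda>x. (- 1) * S x))"
    by (rule nsq_triangle[OF R sqint_scale[OF S]])
  also have "nsq lborel (\<lambda>x. (- 1) * S x) = nsq lborel S"
    unfolding nsq_scale by simp
  finally have "L2_norm (\<lambda>x. L x - g x) \<le> 2 * L2_norm (\<lambda>x. f x - g x) + 1"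
    using R_le S_le unfolding L2_norm_eq_nsq \<epsilon>2_def by linarith
  moreover have "is_synthesis \<nu> (restrict_seq (thresh_set \<nu> f \<beta>) (analysis_op \<nu> f)) L"
    using is_synthesis_finite[OF \<nu> T, of ?c]
    by (simp add: L_def[abs_def] T_def analysis_op_def L2_inner_eq_ip)
  ultimately show ?thesis using \<beta> by blast
qed

section \<open>The band-limited line image\<close>

lemma image_weight_continuous: "image_weight \<rho> w \<Longrightarrow> continuous_on UNIV w"
  by (simp add: image_weight_def smooth_continuous)

lemma image_weight_range: "image_weight \<rho> w \<Longrightarrow> 0 \<le> w x" "image_weight \<rho> w \<Longrightarrow> w x \<le> 1"
  by (simp_all add: image_weight_def)

lemma image_weight_outside: "image_weight \<rho> w \<Longrightarrow> x \<notin> {-\<rho>..\<rho>} \<Longrightarrow> w x = 0"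
  by (simp add: image_weight_def)

lemma image_weight_integrable:
  assumes w: "image_weight \<rho> w"
  shows "integrable lborel w"
proof -
  have "integrable lborel (\<lambda>x. indicator {-\<rho>..\<rho>} x *\<^sub>R w x)"
    by (intro borel_integrable_compact continuous_on_subset[OF image_weight_continuous[OF w]]) auto
  moreover have "(\<lambda>x. indicator {-\<rho>..\<rho>} x *\<^sub>R w x) = w"
    using image_weight_outside[OF w] by (auto simp: fun_eq_iff indicator_def)
  ultimately show ?thesis by simp
qed

definition weight_hat :: "(real \<Rightarrow> real) \<Rightarrow> real \<Rightarrow> complex" where
  "weight_hat w t = (\<integral>y. complex_of_real (w y) * cis (- 2 * pi * (y * t)) \<partial>lborel)"

lemma weight_hat_continuous:
  assumes w: "image_weight \<rho> w"
  shows "continuous_on UNIV (weight_hat w)"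
  unfolding continuous_on_sequentially
proof (intro allI ballI impI, elim conjE)
  fix t :: real and u :: "nat \<Rightarrow> real"
  assume u: "u \<longlonglongrightarrow> t"
  have cont: "continuous_on UNIV (\<lambda>y. complex_of_real (w y) * cis (- 2 * pi * (y * s)))" for s
    by (intro continuous_intros image_weight_continuous[OF w])
  have "(\<lambda>n. weight_hat w (u n)) \<longlonglongrightarrow> weight_hat w t"
    unfolding weight_hat_def
  proof (rule integral_dominated_convergence[where w = w])
    show "(\<lambda>y. complex_of_real (w y) * cis (- 2 * pi * (y * t))) \<in> borel_measurable lborel"
      using borel_measurable_continuous_onI[OF cont] by simp
    show "(\<lambda>y. complex_of_real (w y) * cis (- 2 * pi * (y * u n))) \<in> borel_measurable lborel" for n
      using borel_measurable_continuous_onI[OF cont] by simp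
    show "integrable lborel w" by (rule image_weight_integrable[OF w])
    show "AE y in lborel. (\<lambda>n. complex_of_real (w y) * cis (- 2 * pi * (y * u n)))
        \<longlonglongrightarrow> complex_of_real (w y) * cis (- 2 * pi * (y * t))"
      by (intro AE_I2 tendsto_intros u)
    show "AE y in lborel. cmod (complex_of_real (w y) * cis (- 2 * pi * (y * u n))) \<le> w y" for n
      by (intro AE_I2) (simp add: norm_mult image_weight_range(1)[OF w])
  qed
  then show "(weight_hat w \<circ> u) \<longlonglongrightarrow> weight_hat w t" by (simp add: o_def)
qed

text \<open>The value at 0 is the integral of a continuous nonnegative function that is positive somewhere.\<close>

lemma weight_hat_0_nonzero:
  assumes w: "image_weight \<rho> w"
  shows "weight_hat w 0 \<noteq> 0"
proof -
  obtain x0 where "w x0 \<noteq> 0" using w unfolding image_weight_def by blast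
  then have pos: "w x0 > 0" using image_weight_range(1)[OF w, of x0] by simp
  have "isCont w x0"
    using image_weight_continuous[OF w] by (simp add: continuous_on_eq_continuous_at)
  then obtain d where d: "d > 0" "\<And>x. \<bar>x - x0\<bar> < d \<Longrightarrow> \<bar>w x - w x0\<bar> < w x0 / 2"
    using pos unfolding continuous_at_eps_delta dist_real_def by (meson half_gt_zero)
  define I where "I = {x0 - d/2..x0 + d/2}"
  have "0 < d * (w x0 / 2)" using d(1) pos by simp
  also have "\<dots> = (\<integral>x. indicator I x * (w x0 / 2) \<partial>lborel)"
    using d(1) by (simp add: I_def)
  also have "\<dots> \<le> (\<integral>x. w x \<partial>lborel)"
  proof (rule integral_mono)
    show "integrable lborel (\<lambda>x. indicator I x * (w x0 / 2))"
      by (intro integrable_mult_left integrable_real_indicator) (simp_all add: I_def emeasure_lborel_Icc_eq)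
    show "integrable lborel w" by (rule image_weight_integrable[OF w])
    fix x
    show "indicator I x * (w x0 / 2) \<le> w x"
    proof (cases "x \<in> I")
      case True
      then have "\<bar>x - x0\<bar> < d" using d(1) by (auto simp: I_def)
      then have "w x0 / 2 \<le> w x" using d(2)[of x] by linarith
      then show ?thesis using True by simp
    next
      case False
      then show ?thesis using image_weight_range(1)[OF w] by simp
    qed
  qed
  finally show ?thesis by (simp add: weight_hat_def)
qed

lemma convolution_line_integral:
  assumes w: "image_weight \<rho> w"
  shows "dist_conv (wL \<rho> w) K x = (\<integral>y. complex_of_real (w y) * K (x - (y, 0)) \<partial>lborel)"
proof -
  have "indicator {-\<rho>..\<rho>} y *\<^sub>R (complex_of_real (w y) * K (x - (y, 0)))
      = complex_of_real (w y) * K (x - (y, 0))" for y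
    using image_weight_outside[OF w, of y] by (cases "y \<in> {-\<rho>..\<rho>}") auto
  then show ?thesis
    unfolding dist_conv_def wL_def set_lebesgue_integral_def by simp
qed

text \<open>The line carries no information in the second coordinate, so convolving with it multiplies the
  spectrum by a function of \<open>\<xi>\<^sub>1\<close> alone.\<close>

lemma convolution_fourier_inv:
  assumes w: "image_weight \<rho> w" and F: "bandlim F"
  shows "dist_conv (wL \<rho> w) (fourier_inv F) = fourier_inv (\<lambda>\<xi>. weight_hat w (fst \<xi>) * F \<xi>)"
proof
  fix x
  let ?f = "\<lambda>y \<xi>. complex_of_real (w y) * (F \<xi> * wave (x - (y, 0)) \<xi>)"
  have "integrable (lborel \<Otimes>\<^sub>M lborel) (case_prod ?f)"
  proof (rule Bochner_Integration.integrable_bound)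
    show "integrable (lborel \<Otimes>\<^sub>M lborel) (\<lambda>z. complex_of_real (w (fst z)) * F (snd z))"
      using image_weight_integrable[OF w] bandlim_integrable[OF F]
      by (intro integrable_mult_lborel_prod) auto
    have "continuous_on UNIV (\<lambda>z::real \<times> real \<times> real. ?f (fst z) (snd z))"
      unfolding wave_def
      by (intro continuous_intros continuous_on_compose2[OF image_weight_continuous[OF w]]
          continuous_on_compose2[OF bandlim_continuous[OF F]]) auto
    from borel_measurable_continuous_onI[OF this]
    show "case_prod ?f \<in> borel_measurable (lborel \<Otimes>\<^sub>M lborel)"
      by (simp add: lborel_prod case_prod_beta')
  qed (simp add: norm_mult case_prod_beta')
  from lborel_pair.Fubini_integral[OF this]
  have swap: "(\<integral>y. (\<integral>\<xi>. ?f y \<xi> \<partial>lborel) \<partial>lborel) = (\<integral>\<xi>. (\<integral>y. ?f y \<xi> \<partial>lborel) \<partial>lborel)"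
    by simp
  have inner: "(\<integral>y. ?f y \<xi> \<partial>lborel) = weight_hat w (fst \<xi>) * F \<xi> * wave x \<xi>" for \<xi>
  proof -
    have "wave (x - (y, 0)) \<xi> = cis (- 2 * pi * (y * fst \<xi>)) * wave x \<xi>" for y
      by (simp add: wave_def inner_diff_left inner_prod_def cis_mult algebra_simps)
    then have "(\<integral>y. ?f y \<xi> \<partial>lborel)
        = (\<integral>y. complex_of_real (w y) * cis (- 2 * pi * (y * fst \<xi>)) * (F \<xi> * wave x \<xi>) \<partial>lborel)"
      by (simp only: mult_ac)
    also have "\<dots> = weight_hat w (fst \<xi>) * (F \<xi> * wave x \<xi>)"
      unfolding weight_hat_def by (rule integral_mult_left_zero)
    finally show ?thesis by (simp only: mult.assoc)
  qed
  have "dist_conv (wL \<rho> w) (fourier_inv F) x = (\<integral>y. (\<integral>\<xi>. ?f y \<xi> \<partial>lborel) \<partial>lborel)"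
    unfolding convolution_line_integral[OF w] fourier_inv_wave by simp
  also have "\<dots> = fourier_inv (\<lambda>\<xi>. weight_hat w (fst \<xi>) * F \<xi>) x"
    unfolding swap inner fourier_inv_wave ..
  finally show "dist_conv (wL \<rho> w) (fourier_inv F) x = fourier_inv (\<lambda>\<xi>. weight_hat w (fst \<xi>) * F \<xi>) x" .
qed

lemma mask_sets [measurable]: "mask h \<in> sets borel"
proof -
  have "mask h = {x. \<bar>fst x\<bar> \<le> h}" by (simp add: mask_def)
  moreover have "closed {x :: real \<times> real. \<bar>fst x\<bar> \<le> h}"
    by (intro closed_Collect_le continuous_intros)
  ultimately show ?thesis by simp
qed

text \<open>Cauchy-Schwarz along a horizontal line. The bound is independent of \<open>x\<^sub>1\<close>, which is what makes the energy
  in a thin vertical strip proportional to its width.\<close>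

lemma convolution_pointwise_bound:
  assumes w: "image_weight \<rho> w" and K [measurable]: "K \<in> borel_measurable borel" and "\<rho> > 0"
  shows "ennreal ((cmod (dist_conv (wL \<rho> w) K x))\<^sup>2)
    \<le> ennreal (2 * \<rho>) * (\<integral>\<^sup>+t. ennreal ((cmod (K (t, snd x)))\<^sup>2) \<partial>lborel)"
proof -
  let ?g = "dist_conv (wL \<rho> w) K x"
  have [measurable]: "w \<in> borel_measurable borel"
    by (rule borel_measurable_continuous_onI[OF image_weight_continuous[OF w]])
  have shift: "K (x - (y, 0)) = K (fst x - y, snd x)" for y
    by (cases x) simp
  have Km [measurable]: "(\<lambda>t. K (t, snd x)) \<in> borel_measurable borel"
    by (rule measurable_compose[OF _ K]) (intro borel_measurable_continuous_onI continuous_intros)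
  have Km' [measurable]: "(\<lambda>y. K (fst x - y, snd x)) \<in> borel_measurable borel"
    by (rule measurable_compose[OF _ K]) (intro borel_measurable_continuous_onI continuous_intros)
  have "ennreal (cmod ?g) \<le> (\<integral>\<^sup>+y. ennreal (w y) * ennreal (cmod (K (fst x - y, snd x))) \<partial>lborel)"
  proof (cases "integrable lborel (\<lambda>y. complex_of_real (w y) * K (x - (y, 0)))")
    case True
    have "ennreal (cmod ?g) \<le> (\<integral>\<^sup>+y. ennreal (cmod (complex_of_real (w y) * K (x - (y, 0)))) \<partial>lborel)"
      unfolding convolution_line_integral[OF w] by (rule integral_norm_bound_ennreal[OF True])
    then show ?thesis
      by (simp add: norm_mult image_weight_range(1)[OF w] shift ennreal_mult)
  next
    case False
    then show ?thesis
      by (simp add: convolution_line_integral[OF w] not_integrable_integral_eq)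
  qed
  then have "(ennreal (cmod ?g))\<^sup>2
      \<le> (\<integral>\<^sup>+y. ennreal (w y) * ennreal (cmod (K (fst x - y, snd x))) \<partial>lborel)\<^sup>2"
    by (rule power_mono) simp
  also have "\<dots> \<le> (\<integral>\<^sup>+y. (ennreal (w y))\<^sup>2 \<partial>lborel)
      * (\<integral>\<^sup>+y. (ennreal (cmod (K (fst x - y, snd x))))\<^sup>2 \<partial>lborel)"
    by (rule Cauchy_Schwarz_nn_integral) measurable
  also have "\<dots> \<le> ennreal (2 * \<rho>) * (\<integral>\<^sup>+t. ennreal ((cmod (K (t, snd x)))\<^sup>2) \<partial>lborel)"
  proof (rule mult_mono)
    have "(ennreal (w y))\<^sup>2 \<le> indicator {-\<rho>..\<rho>} y" for y
    proof (cases "y \<in> {-\<rho>..\<rho>}")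
      case True
      have "(w y)\<^sup>2 \<le> 1"
        using image_weight_range[OF w, of y] by (simp add: power_le_one)
      then show ?thesis using True image_weight_range(1)[OF w, of y] by (simp add: ennreal_power)
    next
      case False
      then show ?thesis using image_weight_outside[OF w, of y] by simp
    qed
    then have "(\<integral>\<^sup>+y. (ennreal (w y))\<^sup>2 \<partial>lborel) \<le> (\<integral>\<^sup>+y. indicator {-\<rho>..\<rho>} y \<partial>lborel)"
      by (intro nn_integral_mono)
    also have "\<dots> = ennreal (2 * \<rho>)" using \<open>\<rho> > 0\<close> by simp
    finally show "(\<integral>\<^sup>+y. (ennreal (w y))\<^sup>2 \<partial>lborel) \<le> ennreal (2 * \<rho>)" .
    have "(\<integral>\<^sup>+t. ennreal ((cmod (K (t, snd x)))\<^sup>2) \<partial>lborel)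
        = (\<integral>\<^sup>+y. ennreal ((cmod (K (fst x - y, snd x)))\<^sup>2) \<partial>lborel)"
      by (subst nn_integral_real_affine[where c = "-1" and t = "fst x"]) simp_all
    then show "(\<integral>\<^sup>+y. (ennreal (cmod (K (fst x - y, snd x))))\<^sup>2 \<partial>lborel)
        \<le> (\<integral>\<^sup>+t. ennreal ((cmod (K (t, snd x)))\<^sup>2) \<partial>lborel)"
      by (simp add: ennreal_power)
  qed simp_all
  finally show ?thesis by (simp add: ennreal_power)
qed

text \<open>Integrate the pointwise bound over the strip; the integrals along the horizontal lines add up to the energy
  of \<open>K\<close>.\<close>

lemma strip_energy:
  assumes w: "image_weight \<rho> w" and K: "K \<in> sqint lborel" and "\<rho> > 0" "h > 0"
    and g: "dist_conv (wL \<rho> w) K \<in> borel_measurable borel"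
  shows "nsq lborel (\<lambda>x. indicator (mask h) x * dist_conv (wL \<rho> w) K x) \<le> 4 * h * \<rho> * nsq lborel K"
proof -
  let ?g = "dist_conv (wL \<rho> w) K"
  define J where "J t = (\<integral>\<^sup>+s. ennreal ((cmod (K (s, t)))\<^sup>2) \<partial>lborel)" for t
  have K' [measurable]: "K \<in> borel_measurable borel" using sqint_measurable[OF K] by simp
  have KK [measurable]: "K \<in> borel_measurable (lborel \<Otimes>\<^sub>M lborel)" by (simp add: lborel_prod)
  have J: "J \<in> borel_measurable lborel"
    unfolding J_def by measurable
  have "(\<integral>\<^sup>+x. ennreal ((cmod (indicator (mask h) x * ?g x))\<^sup>2) \<partial>lborel)
      \<le> (\<integral>\<^sup>+x. indicator {-h..h} (fst x) * (ennreal (2 * \<rho>) * J (snd x)) \<partial>lborel)"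
  proof (rule nn_integral_mono)
    fix x
    show "ennreal ((cmod (indicator (mask h) x * ?g x))\<^sup>2)
        \<le> indicator {-h..h} (fst x) * (ennreal (2 * \<rho>) * J (snd x))"
      using convolution_pointwise_bound[OF w K' \<open>\<rho> > 0\<close>, of x]
      by (cases "x \<in> mask h") (auto simp: mask_def J_def abs_le_iff)
  qed
  also have "\<dots> = (\<integral>\<^sup>+s. \<integral>\<^sup>+t. indicator {-h..h} s * (ennreal (2 * \<rho>) * J t) \<partial>lborel \<partial>lborel)"
    using J by (subst lborel_prod[symmetric], subst lborel.nn_integral_fst[symmetric]) auto
  also have "\<dots> = ennreal (2 * h) * (ennreal (2 * \<rho>) * (\<integral>\<^sup>+t. J t \<partial>lborel))"
    using J \<open>h > 0\<close> by (simp add: nn_integral_cmult nn_integral_multc)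
  also have "(\<integral>\<^sup>+t. J t \<partial>lborel) = (\<integral>\<^sup>+x. ennreal ((cmod (K x))\<^sup>2) \<partial>(lborel \<Otimes>\<^sub>M lborel))"
    unfolding J_def by (rule lborel_pair.nn_integral_snd) measurable
  also have "\<dots> = ennreal (nsq lborel K)"
    unfolding nsq_def lborel_prod using sqint_integrable[OF K] by (simp add: nn_integral_eq_integral)
  also have "ennreal (2 * h) * (ennreal (2 * \<rho>) * ennreal (nsq lborel K)) = ennreal (4 * h * \<rho> * nsq lborel K)"
    using \<open>h > 0\<close> \<open>\<rho> > 0\<close> by (simp flip: ennreal_mult add: mult_ac)
  finally have bound: "(\<integral>\<^sup>+x. ennreal ((cmod (indicator (mask h) x * ?g x))\<^sup>2) \<partial>lborel)
      \<le> ennreal (4 * h * \<rho> * nsq lborel K)" .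
  have "nsq lborel (\<lambda>x. indicator (mask h) x * ?g x)
      = enn2real (\<integral>\<^sup>+x. ennreal ((cmod (indicator (mask h) x * ?g x))\<^sup>2) \<partial>lborel)"
    unfolding nsq_def using g by (intro integral_eq_nn_integral) auto
  also have "\<dots> \<le> 4 * h * \<rho> * nsq lborel K"
    using enn2real_mono[OF bound] \<open>h > 0\<close> \<open>\<rho> > 0\<close> by simp
  finally show ?thesis .
qed

section \<open>Energy of the image inside and outside the mask\<close>

lemma F_filter_continuous:
  assumes "meyer_aux \<nu>"
  shows "continuous_on UNIV (F_filter \<nu> j)"
  unfolding F_filter_def by (intro continuous_intros assms)

lemma F_filter_support:
  assumes "\<bar>fst \<xi>\<bar> > 2 ^ (2 * j) / 2 \<or> \<bar>snd \<xi>\<bar> > 2 ^ (2 * j) / 2"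
  shows "F_filter \<nu> j \<xi> = 0"
proof -
  have "(2::real) ^ (2 * j) / 4 \<le> 2 ^ (2 * j) / 2" "(2::real) ^ (2 * j + 1) / 4 = 2 ^ (2 * j) / 2"
    by simp_all
  then have "\<bar>fst \<xi>\<bar> > 2 ^ (2 * j) / 4 \<or> \<bar>snd \<xi>\<bar> > 2 ^ (2 * j) / 4"
    "\<bar>fst \<xi>\<bar> > 2 ^ (2 * j + 1) / 4 \<or> \<bar>snd \<xi>\<bar> > 2 ^ (2 * j + 1) / 4"
    using assms by linarith+
  then have "W2 \<nu> \<iota> (\<xi> /\<^sub>R 2 ^ (2 * j)) = 0" "W2 \<nu> \<iota> (\<xi> /\<^sub>R 2 ^ (2 * j + 1)) = 0" for \<iota>
    by (intro W2_dilate_support; simp)+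
  then show ?thesis by (simp add: F_filter_def)
qed

lemma F_filter_bandlim: "meyer_aux \<nu> \<Longrightarrow> bandlim (F_filter \<nu> j)"
  by (rule bandlimI[OF F_filter_continuous F_filter_support])

lemma F_filter_norm_le:
  assumes \<nu>: "meyer_aux \<nu>"
  shows "cmod (F_filter \<nu> j \<xi>) \<le> 6"
proof -
  have "cmod (F_filter \<nu> j \<xi>)
      \<le> (\<Sum>\<iota>\<in>{Hor, Ver, Dia}. cmod (W2 \<nu> \<iota> (\<xi> /\<^sub>R 2 ^ (2 * j)) + W2 \<nu> \<iota> (\<xi> /\<^sub>R 2 ^ (2 * j + 1))))"
    unfolding F_filter_def by (rule norm_sum)
  also have "\<dots> \<le> (\<Sum>\<iota>\<in>{Hor, Ver, Dia}. 1 + 1)"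
    by (rule sum_mono, rule order_trans[OF norm_triangle_ineq], rule add_mono) (rule norm_W2_le_1[OF \<nu>])+
  finally show ?thesis by simp
qed

lemma nsq_F_filter_le:
  assumes \<nu>: "meyer_aux \<nu>"
  shows "nsq lborel (F_filter \<nu> j) \<le> 36 * (2 ^ (2 * j))\<^sup>2"
proof -
  define s where "s = (2::real) ^ (2 * j)"
  have s: "s > 0" by (simp add: s_def)
  define B where "B = cbox (- (s/2), - (s/2)) (s/2, s/2)"
  have B: "B \<in> sets borel" by (simp add: B_def)
  have B_fin: "emeasure lborel B < \<infinity>" unfolding B_def by (rule emeasure_lborel_cbox_finite)
  have B_area: "measure lborel B = s\<^sup>2"
    unfolding B_def content_Pair using s by (simp add: power2_eq_square)
  have "nsq lborel (F_filter \<nu> j) \<le> (\<integral>\<xi>. indicator B \<xi> * 36 \<partial>lborel)"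
    unfolding nsq_def
  proof (rule integral_mono)
    show "integrable lborel (\<lambda>\<xi>. (cmod (F_filter \<nu> j \<xi>))\<^sup>2)"
      by (rule sqint_integrable[OF bandlim_sqint[OF F_filter_bandlim[OF \<nu>]]])
    show "integrable lborel (\<lambda>\<xi>. indicator B \<xi> * (36::real))"
      using B B_fin by (intro integrable_mult_left integrable_real_indicator) simp_all
    fix \<xi> :: "real \<times> real"
    show "(cmod (F_filter \<nu> j \<xi>))\<^sup>2 \<le> indicator B \<xi> * 36"
    proof (cases "\<bar>fst \<xi>\<bar> > s / 2 \<or> \<bar>snd \<xi>\<bar> > s / 2")
      case True
      then show ?thesis using F_filter_support[of j \<xi> \<nu>] by (simp add: s_def)
    next
      case False
      then have "\<xi> \<in> B" by (cases \<xi>) (auto simp: B_def cbox_Pair_eq abs_le_iff not_less)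
      moreover have "(cmod (F_filter \<nu> j \<xi>))\<^sup>2 \<le> 6\<^sup>2"
        by (intro power_mono F_filter_norm_le \<nu>) simp
      ultimately show ?thesis by simp
    qed
  qed
  also have "\<dots> = 36 * s\<^sup>2" using B_area B by simp
  finally show ?thesis by (simp add: s_def)
qed

text \<open>For small \<open>\<xi>\<^sub>1\<close> the horizontal and diagonal windows vanish and the vertical ones have first factor 1.
  On this strip the filter is a dilate of a function of one variable, which reduces its lower bound
  to a statement about \<open>W\<close>.\<close>

lemma F_filter_vertical_strip:
  assumes \<nu>: "meyer_aux \<nu>" and "\<bar>fst \<xi>\<bar> \<le> 1/16"
  shows "F_filter \<nu> j \<xi> = W \<nu> (snd \<xi> / 2 ^ (2 * j)) + W \<nu> (snd \<xi> / 2 ^ (2 * j) / 2)"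
proof -
  have small: "W \<nu> t = 0 \<and> phi_hat \<nu> t = 1" if "\<bar>t\<bar> \<le> 1/16" for t
  proof -
    have "\<nu> (16 * \<bar>t\<bar> - 1) = 0" by (rule meyer_aux_le[OF \<nu>]) (use that in linarith)
    then have "W \<nu> t = 0" unfolding W_eq[OF \<nu>] by simp
    moreover have "phi_hat \<nu> t = 1" unfolding phi_hat_eq_cutoff[OF \<nu>] cutoff_inner[OF \<nu> that] by simp
    ultimately show ?thesis ..
  qed
  have "\<bar>inverse (2 ^ n) * fst \<xi>\<bar> \<le> 1/16" for n
  proof -
    have "\<bar>inverse (2 ^ n) * fst \<xi>\<bar> \<le> 1 * \<bar>fst \<xi>\<bar>"
      unfolding abs_mult by (intro mult_right_mono) (simp_all add: field_simps)
    then show ?thesis using assms(2) by linarith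
  qed
  note 1 = small[OF this]
  have sum: "(\<Sum>\<iota>\<in>{Hor, Ver, Dia}. G \<iota>) = G Hor + (G Ver + G Dia)" for G :: "orientation \<Rightarrow> complex"
    by simp
  have "F_filter \<nu> j \<xi> = W \<nu> (inverse (2 ^ (2 * j)) * snd \<xi>) + W \<nu> (inverse (2 ^ (2 * j + 1)) * snd \<xi>)"
    unfolding F_filter_def sum W2_components fst_scaleR snd_scaleR real_scaleR_def
    by (simp only: 1) simp
  moreover have "inverse (2 ^ (2 * j + 1)) * snd \<xi> = snd \<xi> / 2 ^ (2 * j) / 2"
    unfolding divide_divide_eq_left power_add power_one_right by (rule divide_inverse_commute[symmetric])
  moreover have "inverse (2 ^ (2 * j)) * snd \<xi> = snd \<xi> / 2 ^ (2 * j)"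
    by (rule divide_inverse_commute[symmetric])
  ultimately show ?thesis
    by simp
qed

lemma wL_band_eq:
  assumes "meyer_aux \<nu>" "image_weight \<rho> w"
  shows "wL_band \<nu> \<rho> w j = fourier_inv (\<lambda>\<xi>. weight_hat w (fst \<xi>) * F_filter \<nu> j \<xi>)"
  unfolding wL_band_def by (rule convolution_fourier_inv[OF assms(2) F_filter_bandlim[OF assms(1)]])

lemma wL_band_hat_bandlim:
  assumes \<nu>: "meyer_aux \<nu>" and w: "image_weight \<rho> w"
  shows "bandlim (\<lambda>\<xi>. weight_hat w (fst \<xi>) * F_filter \<nu> j \<xi>)"
  by (intro bandlim_mult_left F_filter_bandlim \<nu> continuous_on_compose2[OF weight_hat_continuous[OF w]]
      continuous_intros) auto

text \<open>The profile \<open>V \<eta> = W \<eta> + W (\<eta> / 2)\<close> has modulus 1 at \<open>\<eta> = 1/4\<close>: the first term has just died out and the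
  second is at its peak. Continuity gives a box of width independent of \<open>j\<close> and height
  proportional to \<open>s\<close> on which the spectrum is bounded below.\<close>

lemma wL_band_energy_lower:
  assumes \<nu>: "meyer_aux \<nu>" and w: "image_weight \<rho> w"
  shows "\<exists>c>0. \<forall>j. c * 2 ^ (2 * j) \<le> nsq lborel (wL_band \<nu> \<rho> w j)"
proof -
  define m where "m = cmod (weight_hat w 0) / 2"
  have m: "m > 0" using weight_hat_0_nonzero[OF w] by (simp add: m_def)
  define V where "V \<eta> = W \<nu> \<eta> + W \<nu> (\<eta> / 2)" for \<eta>
  have "isCont (\<lambda>t. cmod (weight_hat w t)) 0"
    using weight_hat_continuous[OF w]
    by (intro continuous_intros) (simp add: continuous_on_eq_continuous_at)
  then have "((\<lambda>t. cmod (weight_hat w t)) \<longlongrightarrow> cmod (weight_hat w 0)) (nhds 0)"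
    unfolding isCont_def by (rule tendsto_at_iff_tendsto_nhds[THEN iffD1])
  then have "eventually (\<lambda>t. m < cmod (weight_hat w t)) (nhds 0)"
    by (rule order_tendstoD(1)) (use m in \<open>simp add: m_def\<close>)
  then obtain d1 where d1: "d1 > 0" "\<And>t. \<bar>t\<bar> < d1 \<Longrightarrow> m < cmod (weight_hat w t)"
    unfolding eventually_nhds_metric dist_real_def by auto
  have "continuous_on UNIV V" unfolding V_def by (intro continuous_intros \<nu>) simp
  then have "isCont (\<lambda>\<eta>. cmod (V \<eta>)) (1/4)"
    by (intro continuous_intros) (simp add: continuous_on_eq_continuous_at)
  then have "((\<lambda>\<eta>. cmod (V \<eta>)) \<longlongrightarrow> cmod (V (1/4))) (nhds (1/4))"
    unfolding isCont_def by (rule tendsto_at_iff_tendsto_nhds[THEN iffD1])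
  moreover have "cmod (V (1/4)) = 1"
  proof -
    have "\<nu> 1 = 1" by (rule meyer_aux_ge[OF \<nu>]) simp
    then show ?thesis
      using cutoff_outer[OF \<nu>, of "1/8"] cutoff_inner[OF \<nu>, of "1/16"]
      by (simp add: V_def W_eq[OF \<nu>] norm_mult)
  qed
  ultimately have "eventually (\<lambda>\<eta>. 1/2 < cmod (V \<eta>)) (nhds (1/4))"
    using order_tendstoD(1)[of "\<lambda>\<eta>. cmod (V \<eta>)" "cmod (V (1/4))" "nhds (1/4)" "1/2"] by simp
  then obtain d2 where d2: "d2 > 0" "\<And>\<eta>. \<bar>\<eta> - 1/4\<bar> < d2 \<Longrightarrow> 1/2 < cmod (V \<eta>)"
    unfolding eventually_nhds_metric dist_real_def by auto
  define a where "a = min (d1 / 2) (1/16)"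
  have a: "a > 0" "a < d1" "a \<le> 1/16" using d1(1) by (auto simp: a_def min_def)
  define c where "c = (m / 2)\<^sup>2 * (2 * a * (d2 / 2))"
  have "c > 0" using m a(1) d2(1) by (simp add: c_def)
  moreover have "c * 2 ^ (2 * j) \<le> nsq lborel (wL_band \<nu> \<rho> w j)" for j
  proof -
    define s where "s = (2::real) ^ (2 * j)"
    have s: "s > 0" by (simp add: s_def)
    define H where "H \<xi> = weight_hat w (fst \<xi>) * F_filter \<nu> j \<xi>" for \<xi>
    have H: "bandlim H" unfolding H_def by (rule wL_band_hat_bandlim[OF \<nu> w])
    define B where "B = cbox (- a, s / 4) (a, s / 4 + s * (d2 / 2))"
    have B: "B \<in> sets borel" by (simp add: B_def)
    have B_fin: "emeasure lborel B < \<infinity>" unfolding B_def by (rule emeasure_lborel_cbox_finite)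
    have B_area: "measure lborel B = 2 * a * (s * (d2 / 2))"
      unfolding B_def content_Pair using s a(1) d2(1) by simp
    have "c * s = (\<integral>\<xi>. indicator B \<xi> * (m / 2)\<^sup>2 \<partial>lborel)"
      using B B_area by (simp add: c_def)
    also have "\<dots> \<le> nsq lborel H"
      unfolding nsq_def
    proof (rule integral_mono)
      show "integrable lborel (\<lambda>\<xi>. indicator B \<xi> * (m / 2)\<^sup>2)"
        using B B_fin by (intro integrable_mult_left integrable_real_indicator) simp_all
      show "integrable lborel (\<lambda>\<xi>. (cmod (H \<xi>))\<^sup>2)"
        by (rule sqint_integrable[OF bandlim_sqint[OF H]])
      fix \<xi> :: "real \<times> real"
      show "indicator B \<xi> * (m / 2)\<^sup>2 \<le> (cmod (H \<xi>))\<^sup>2"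
      proof (cases "\<xi> \<in> B")
        case True
        then have x1: "\<bar>fst \<xi>\<bar> \<le> a" and x2: "s / 4 \<le> snd \<xi>" "snd \<xi> \<le> s / 4 + s * (d2 / 2)"
          by (cases \<xi>; auto simp: B_def cbox_Pair_eq abs_le_iff)+
        have "1/4 \<le> snd \<xi> / s" "snd \<xi> / s \<le> 1/4 + d2 / 2"
          using x2 s by (simp_all add: pos_le_divide_eq pos_divide_le_eq algebra_simps)
        then have "1/2 < cmod (V (snd \<xi> / s))"
          using d2(1) by (intro d2(2)) linarith
        moreover have "F_filter \<nu> j \<xi> = V (snd \<xi> / s)"
          unfolding V_def s_def using x1 a(3) by (intro F_filter_vertical_strip \<nu>) linarith
        moreover have "m < cmod (weight_hat w (fst \<xi>))"
          using x1 a(2) by (intro d1(2)) linarith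
        ultimately have "m * (1/2) \<le> cmod (H \<xi>)"
          unfolding H_def norm_mult using m by (intro mult_mono) simp_all
        then have "(m / 2)\<^sup>2 \<le> (cmod (H \<xi>))\<^sup>2"
          using m by (intro power_mono) simp_all
        then show ?thesis using True by simp
      qed simp
    qed
    also have "nsq lborel H = nsq lborel (wL_band \<nu> \<rho> w j)"
      unfolding wL_band_eq[OF \<nu> w] H_def[symmetric] by (rule Plancherel_nsq[OF H, symmetric])
    finally show ?thesis by (simp add: s_def)
  qed
  ultimately show ?thesis by blast
qed

lemma wL_band_masked_energy:
  assumes \<nu>: "meyer_aux \<nu>" and w: "image_weight \<rho> w" and "\<rho> > 0" "h > 0"
  shows "nsq lborel (\<lambda>x. indicator (mask h) x * wL_band \<nu> \<rho> w j x) \<le> 144 * \<rho> * h * (2 ^ (2 * j))\<^sup>2"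
proof -
  have "fourier_inv (F_filter \<nu> j) \<in> sqint lborel"
    by (rule fourier_inv_sqint[OF F_filter_bandlim[OF \<nu>]])
  moreover have "wL_band \<nu> \<rho> w j \<in> borel_measurable borel"
    unfolding wL_band_eq[OF \<nu> w] by (rule fourier_inv_measurable[OF wL_band_hat_bandlim[OF \<nu> w]])
  ultimately have "nsq lborel (\<lambda>x. indicator (mask h) x * wL_band \<nu> \<rho> w j x)
      \<le> 4 * h * \<rho> * nsq lborel (fourier_inv (F_filter \<nu> j))"
    unfolding wL_band_def using assms by (intro strip_energy)
  also have "\<dots> = 4 * h * \<rho> * nsq lborel (F_filter \<nu> j)"
    by (simp add: Plancherel_nsq[OF F_filter_bandlim[OF \<nu>]])
  also have "\<dots> \<le> 4 * h * \<rho> * (36 * (2 ^ (2 * j))\<^sup>2)"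
    using assms by (intro mult_left_mono nsq_F_filter_le) simp_all
  finally show ?thesis by (simp add: mult_ac)
qed

lemma proj_known_sqint:
  assumes g: "g \<in> sqint lborel"
  shows "proj_known h g \<in> sqint lborel"
proof -
  have [measurable]: "g \<in> borel_measurable borel" using sqint_measurable[OF g] by simp
  have "integrable lborel (\<lambda>x. (cmod ((1 - indicator (mask h) x) * g x))\<^sup>2)"
    by (rule Bochner_Integration.integrable_bound[OF sqint_integrable[OF g]])
      (auto simp: indicator_def)
  then show ?thesis by (simp add: proj_known_def sqint_def)
qed

section \<open>Recovery by one-step thresholding\<close>

theorem theorem4p7:
  fixes \<nu> w :: "real \<Rightarrow> real" and \<rho> :: real and h :: "nat \<Rightarrow> real"
    and f :: "nat \<Rightarrow> real \<times> real \<Rightarrow> complex"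
  assumes "meyer_aux \<nu>"
    and "\<rho> > 0" and "image_weight \<rho> w"
    and "\<And>j. h j > 0" and "\<And>j. h j < \<rho>"
    and "h \<in> o(\<lambda>j. 1 / 2 ^ (2 * j))"
    and f: "\<And>j. f j = proj_known (h j) (wL_band \<nu> \<rho> w j)"
  shows "\<exists>\<beta> :: nat \<Rightarrow> real. (\<forall>j. \<beta> j > 0) \<and>
    (\<exists>L :: nat \<Rightarrow> real \<times> real \<Rightarrow> complex.
       (\<forall>j. is_synthesis \<nu> (restrict_seq (thresh_set \<nu> (f j) (\<beta> j)) (analysis_op \<nu> (f j))) (L j)) \<and>
       (\<lambda>j. L2_norm (\<lambda>x. L j x - wL_band \<nu> \<rho> w j x) / L2_norm (wL_band \<nu> \<rho> w j)) \<longlonglongrightarrow> 0)"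
proof -
  note \<nu> = \<open>meyer_aux \<nu>\<close> and w = \<open>image_weight \<rho> w\<close>
  let ?g = "wL_band \<nu> \<rho> w"
  have g: "?g j \<in> sqint lborel" for j
    unfolding wL_band_eq[OF \<nu> w] by (rule fourier_inv_sqint[OF wL_band_hat_bandlim[OF \<nu> w]])
  have f_sqint: "f j \<in> sqint lborel" for j unfolding f by (rule proj_known_sqint[OF g])
  \<comment> \<open>The relation \<open>good\<close> packs threshold and reconstruction together, so that both sequences come from a single choice.\<close>
  define good where "good j \<beta> L \<longleftrightarrow> \<beta> > 0
      \<and> is_synthesis \<nu> (restrict_seq (thresh_set \<nu> (f j) \<beta>) (analysis_op \<nu> (f j))) L
      \<and> L2_norm (\<lambda>x. L x - ?g j x) \<le> 2 * L2_norm (\<lambda>x. f j x - ?g j x) + 1" for j \<beta> L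
  have "\<exists>p. good j (fst p) (snd p)" for j
  proof -
    obtain \<beta> L where "good j \<beta> L"
      using thresholding_error[OF \<nu> f_sqint[of j] wL_band_hat_bandlim[OF \<nu> w, of j]]
      unfolding wL_band_eq[OF \<nu> w, symmetric] good_def by blast
    then show ?thesis by (intro exI[of _ "(\<beta>, L)"]) simp
  qed
  then have "\<exists>p. \<forall>j. good j (fst (p j)) (snd (p j))" by (intro choice allI)
  then obtain p where p: "\<And>j. good j (fst (p j)) (snd (p j))" by blast
  define \<beta> L where "\<beta> j = fst (p j)" and "L j = snd (p j)" for j
  have \<beta>: "\<beta> j > 0"
    and L: "is_synthesis \<nu> (restrict_seq (thresh_set \<nu> (f j) (\<beta> j)) (analysis_op \<nu> (f j))) (L j)"
    and err: "L2_norm (\<lambda>x. L j x - ?g j x) \<le> 2 * L2_norm (\<lambda>x. f j x - ?g j x) + 1" for j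
    using p[of j] unfolding good_def \<beta>_def L_def by blast+
  obtain c where c: "c > 0" "\<And>j. c * 2 ^ (2 * j) \<le> nsq lborel (?g j)"
    using wL_band_energy_lower[OF \<nu> w] by blast
  define s where "s j = (2::real) ^ (2 * j)" for j
  have s: "s j > 0" for j by (simp add: s_def)
  have mask_err: "L2_norm (\<lambda>x. f j x - ?g j x) \<le> 12 * s j * sqrt (\<rho> * h j)" for j
  proof -
    have "(\<lambda>x. f j x - ?g j x) = (\<lambda>x. (- 1) * (indicator (mask (h j)) x * ?g j x))"
      by (simp add: f proj_known_def fun_eq_iff algebra_simps)
    then have "nsq lborel (\<lambda>x. f j x - ?g j x)
        = (cmod (- 1))\<^sup>2 * nsq lborel (\<lambda>x. indicator (mask (h j)) x * ?g j x)"
      by (simp only: nsq_scale)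
    also have "\<dots> \<le> 144 * \<rho> * h j * (s j)\<^sup>2"
      using wL_band_masked_energy[OF \<nu> w \<open>\<rho> > 0\<close> \<open>h j > 0\<close>, of j] by (simp add: s_def)
    finally have "L2_norm (\<lambda>x. f j x - ?g j x) \<le> sqrt (12\<^sup>2 * (s j)\<^sup>2 * (\<rho> * h j))"
      unfolding L2_norm_eq_nsq by (intro real_sqrt_le_mono) (simp add: mult_ac)
    also have "\<dots> = 12 * s j * sqrt (\<rho> * h j)"
      using s[of j] by (simp add: real_sqrt_mult)
    finally show ?thesis .
  qed
  let ?r = "\<lambda>j. L2_norm (\<lambda>x. L j x - ?g j x) / L2_norm (?g j)"
  \<comment> \<open>The bound \<open>(2 * 12 s \<surd>(\<rho> h) + 1) / \<surd>(c s)\<close>, arranged so that each summand visibly tends to 0.\<close>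
  let ?b = "\<lambda>j. 24 * sqrt (\<rho> / c) * sqrt (h j * s j) + 1 / sqrt c * sqrt (1 / s j)"
  have "?r \<longlonglongrightarrow> 0"
  proof (rule tendsto_sandwich)
    show "eventually (\<lambda>j. 0 \<le> ?r j) sequentially"
      by (simp add: L2_norm_eq_nsq)
    have "?r j \<le> ?b j" for j
    proof -
      have cs: "sqrt (c * s j) > 0" using c(1) s by simp
      have "sqrt (c * s j) \<le> L2_norm (?g j)"
        unfolding L2_norm_eq_nsq s_def by (intro real_sqrt_le_mono c(2))
      moreover have "L2_norm (\<lambda>x. L j x - ?g j x) \<le> 24 * s j * sqrt (\<rho> * h j) + 1"
        using err[of j] mask_err[of j] by linarith
      moreover have "0 \<le> L2_norm (\<lambda>x. L j x - ?g j x)" by (simp add: L2_norm_eq_nsq)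
      ultimately have "?r j \<le> (24 * s j * sqrt (\<rho> * h j) + 1) / sqrt (c * s j)"
        using cs by (intro frac_le) linarith+
      also have "\<dots> = 24 * (s j * sqrt (\<rho> * h j) / sqrt (c * s j)) + 1 / sqrt (c * s j)"
        by (simp add: add_divide_distrib)
      also have "s j * sqrt (\<rho> * h j) / sqrt (c * s j) = sqrt (\<rho> / c) * sqrt (h j * s j)"
      proof -
        have "s j = sqrt (s j) * sqrt (s j)" using s[of j] by simp
        then have "s j * sqrt (\<rho> * h j) / sqrt (c * s j)
            = sqrt (s j) * sqrt (s j) * sqrt (\<rho> * h j) / (sqrt c * sqrt (s j))"
          by (simp only: real_sqrt_mult)
        also have "\<dots> = sqrt (s j) * sqrt (\<rho> * h j) / sqrt c"
          using s[of j] by (simp add: divide_simps)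
        also have "\<dots> = sqrt (\<rho> / c) * sqrt (h j * s j)"
          by (simp add: real_sqrt_mult real_sqrt_divide)
        finally show ?thesis .
      qed
      also have "1 / sqrt (c * s j) = 1 / sqrt c * sqrt (1 / s j)"
        by (simp add: real_sqrt_mult real_sqrt_divide)
      finally show ?thesis by (simp only: mult.assoc)
    qed
    then show "eventually (\<lambda>j. ?r j \<le> ?b j) sequentially" by simp
    have "(\<lambda>j. h j * s j) \<longlonglongrightarrow> 0"
      using smalloD_tendsto[OF \<open>h \<in> o(\<lambda>j. 1 / 2 ^ (2 * j))\<close>] by (simp add: s_def)
    moreover have "(\<lambda>j. 1 / s j) \<longlonglongrightarrow> 0"
    proof -
      have "1 / s j = (1/4) ^ j" for j by (simp add: s_def power_mult power_one_over)
      then show ?thesis by (simp add: LIMSEQ_realpow_zero)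
    qed
    ultimately have "?b \<longlonglongrightarrow> 24 * sqrt (\<rho> / c) * sqrt 0 + 1 / sqrt c * sqrt 0"
      by (intro tendsto_intros)
    then show "?b \<longlonglongrightarrow> 0" by simp
  qed simp
  then show ?thesis using \<beta> L by blast
qed

end
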